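(* Let $\theta\in(1,\infty)$. Let $(\mathscr{S}_0,d_0)$ be a complete metric space endowed with an additional topology $\sigma$ that is Hausdorff, weaker than the topology induced by $d_0$, and such that $d_0$ is sequentially $\sigma$-lower semicontinuous, i.e. $d_0(u,v)\le\liminf_{k\to\infty}d_0(u_k,v_k)$ whenever $u_k\overset{\sigma}{\rightharpoonup}u$ and $v_k\overset{\sigma}{\rightharpoonup}v$. Let $\big((\mathscr{S}_\varepsilon,d_\varepsilon)\big)_{\varepsilon>0}$ be metric spaces with $\mathscr{S}_\varepsilon\subset\mathscr{S}_0$, and suppose there is a constant $c_0>0$ such that $d_0(u,v)\le c_0d_\varepsilon(u,v)$ for all $u,v\in\mathscr{S}_\varepsilon$ and all $\varepsilon>0$. Let $\phi:\mathscr{S}_0\to(-\infty,\infty]$ with $\mathscr{D}(\phi)=\{\phi<\infty\}\neq\emptyset$ satisfy: ($\Phi$1) if $u_k\overset{\sigma}{\rightharpoonup}u$ and $\sup_{k,l}d_0(u_k,u_l)<\infty$, then $\phi(u)\le\liminf_{k\to\infty}\phi(u_k)$; ($\Phi$2) there exist $u_*\in\mathscr{S}_0$, $B\in\mathbb{R}$, $C>0$ such that $\phi(u)\ge B-C\,d_0(u,u_* )^\theta$ for all $u\in\mathscr{S}_0$; ($\Phi$3) every sequence $(u_k)\subset\mathscr{S}_0$ with $\sup_k\phi(u_k)<\infty$ and $\sup_{k,l}d_0(u_k,u_l)<\infty$ has a subsequence that $\sigma$-converges to some $u\in\mathscr{S}_0$. Let $u_0\in\mathscr{D}(\phi)$.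 Assume that for every $\varepsilon>0$ there exists $u_{0,\varepsilon}\in\mathscr{S}_\varepsilon$ such that $$\sup_{\varepsilon>0}d_0(u_{0,\varepsilon},u_0)<\infty,\qquad u_{0,\varepsilon}\overset{\sigma}{\rightharpoonup}u_0\ (\varepsilon\to0),\qquad\phi(u_{0,\varepsilon})\to\phi(u_0)\ (\varepsilon\to0),$$ and let $\boldsymbol{u}_\varepsilon\in AC^\theta_{\mathrm{loc}}([0,\infty),(\mathscr{S}_\varepsilon,d_\varepsilon))$ be a $\theta$-curve of maximal slope for $\phi$ (restricted to $\mathscr{S}_\varepsilon$) with respect to the strong upper gradient $g_\varepsilon$ starting at $u_{0,\varepsilon}$. Then there exist a subsequence $\varepsilon_k\to0$ and a curve $\boldsymbol{u}^*\in AC^\theta_{\mathrm{loc}}([0,\infty),(\mathscr{S}_0,d_0))$ such that $\boldsymbol{u}^*(0)=u_0$ and $\boldsymbol{u}_{\varepsilon_k}(t)\overset{\sigma}{\rightharpoonup}\boldsymbol{u}^*(t)$ as $k\to\infty$ for every $t\ge0$. Moreover, $\phi(\boldsymbol{u}^*(t))\le\phi(u_0)$ for all $t\ge0$.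
   Context: For a metric space $(\mathscr{S},d)$ and an interval $I$: $\boldsymbol{u}\in AC^\theta(I,\mathscr{S})$ (resp. $AC^\theta_{\mathrm{loc}}$) if there is $m\in L^\theta(I)$ (resp. $L^\theta_{\mathrm{loc}}(I)$) with $d(\boldsymbol{u}(s),\boldsymbol{u}(t))\le\int_s^tm(r)\,dr$ for all $s<t$ in $I$; $AC=AC^1$. The metric derivative is $|\boldsymbol{u}'|(t)=\lim_{s\to t}\frac{d(\boldsymbol{u}(t),\boldsymbol{u}(s))}{|t-s|}$ (exists a.e.). A map $g:\mathscr{S}\to[0,\infty]$ is a strong upper gradient for $\phi$ (on $\mathscr{D}(\phi)$) if for every $\boldsymbol{v}\in AC(I,\mathscr{D}(\phi))$ the function $g\circ\boldsymbol{v}$ is Borel measurable and $|\phi(\boldsymbol{v}(t))-\phi(\boldsymbol{v}(s))|\le\int_s^tg(\boldsymbol{v}(r))|\boldsymbol{v}'|(r)\,dr$ for all $s<t$ in $I$. A $\theta$-curve of maximal slope for $\phi$ with respect to a strong upper gradient $g$ starting at $w_0\in\mathscr{D}(\phi)$ is $\boldsymbol{u}\in AC^\theta_{\mathrm{loc}}([0,\infty),\mathscr{S})$ with $\boldsymbol{u}(0)=w_0$ and $\phi(\boldsymbol{u}(t))-\phi(\boldsymbol{u}(s))=-\frac1\beta\int_s^tg^\beta(\boldsymbol{u}(r))\,dr-\frac1\theta\int_s^t|\boldsymbol{u}'|^\theta(r)\,dr$ for all $0\le s<t<\infty$, where $\frac1\theta+\frac1\beta=1$. For $\boldsymbol{u}_\varepsilon$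 and $g_\varepsilon$ these notions are taken in $(\mathscr{S}_\varepsilon,d_\varepsilon)$. $\overset{\sigma}{\rightharpoonup}$ denotes convergence in $\sigma$. *)

theory Defs
  imports "HOL-Analysis.Analysis"
begin

definition eff_dom :: "'a set \<Rightarrow> ('a \<Rightarrow> ereal) \<Rightarrow> 'a set" where
  "eff_dom S \<phi> = {u \<in> S. \<phi> u < \<infinity>}"

definition Lp_on :: "real \<Rightarrow> real set \<Rightarrow> (real \<Rightarrow> real) \<Rightarrow> bool" where
  "Lp_on \<theta> I m \<longleftrightarrow>
     set_borel_measurable lebesgue I m \<and> set_integrable lebesgue I (\<lambda>r. \<bar>m r\<bar> powr \<theta>)"

definition Lp_loc_on :: "real \<Rightarrow> real set \<Rightarrow> (real \<Rightarrow> real) \<Rightarrow> bool" where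
  "Lp_loc_on \<theta> I m \<longleftrightarrow> (\<forall>K. compact K \<and> K \<subseteq> I \<longrightarrow> Lp_on \<theta> K m)"

text \<open>
  For curves, only the values on the interval \<open>I\<close> matter.  The integral of \<open>m\<close> below is a Bochner
  integral; for \<open>\<theta> \<ge> 1\<close> it is never the default value \<open>0\<close> of a non-integrable function, since
  \<open>m\<close> is in \<open>L\<^sup>\<theta>\<close> on the compact interval \<open>{s..t}\<close>.
\<close>

definition AC_curve ::
  "real \<Rightarrow> real set \<Rightarrow> 'a set \<Rightarrow> ('a \<Rightarrow> 'a \<Rightarrow> real) \<Rightarrow> (real \<Rightarrow> 'a) \<Rightarrow> bool" where
  "AC_curve \<theta> I M d u \<longleftrightarrow> u ` I \<subseteq> M \<and>
     (\<exists>m. Lp_on \<theta> I m \<and>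
       (\<forall>s\<in>I. \<forall>t\<in>I. s < t \<longrightarrow> d (u s) (u t) \<le> set_lebesgue_integral lebesgue {s..t} m))"

definition AC_loc_curve ::
  "real \<Rightarrow> real set \<Rightarrow> 'a set \<Rightarrow> ('a \<Rightarrow> 'a \<Rightarrow> real) \<Rightarrow> (real \<Rightarrow> 'a) \<Rightarrow> bool" where
  "AC_loc_curve \<theta> I M d u \<longleftrightarrow> u ` I \<subseteq> M \<and>
     (\<exists>m. Lp_loc_on \<theta> I m \<and>
       (\<forall>s\<in>I. \<forall>t\<in>I. s < t \<longrightarrow> d (u s) (u t) \<le> set_lebesgue_integral lebesgue {s..t} m))"

text \<open>
  Where the limit does not exist (for absolutely continuous curves, a Lebesgue null set) the value
  is unspecified.  All integrals of metric derivatives are taken with respect to the completed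
  measure \<^term>\<open>lebesgue\<close>, so these values affect neither measurability nor the integral.
\<close>

definition metric_deriv ::
  "real set \<Rightarrow> ('a \<Rightarrow> 'a \<Rightarrow> real) \<Rightarrow> (real \<Rightarrow> 'a) \<Rightarrow> real \<Rightarrow> real" where
  "metric_deriv I d u t = Lim (at t within I) (\<lambda>s. d (u t) (u s) / \<bar>t - s\<bar>)"

definition strong_upper_gradient ::
  "'a set \<Rightarrow> ('a \<Rightarrow> 'a \<Rightarrow> real) \<Rightarrow> ('a \<Rightarrow> ereal) \<Rightarrow> ('a \<Rightarrow> ennreal) \<Rightarrow> bool" where
  "strong_upper_gradient M d \<phi> g \<longleftrightarrow>
     (\<forall>I v. is_interval I \<and> AC_curve 1 I (eff_dom M \<phi>) d v \<longrightarrow>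
        (\<lambda>r. g (v r)) \<in> borel_measurable (restrict_space borel I) \<and>
        (\<forall>s\<in>I. \<forall>t\<in>I. s < t \<longrightarrow>
           \<bar>\<phi> (v t) - \<phi> (v s)\<bar>
             \<le> enn2ereal (\<integral>\<^sup>+ r\<in>{s..t}. g (v r) * ennreal (metric_deriv I d v r) \<partial>lebesgue)))"

text \<open>Real powers on \<open>[0,\<infinity>]\<close>; intended for exponents \<open>p > 0\<close>.\<close>

definition ennreal_powr :: "ennreal \<Rightarrow> real \<Rightarrow> ennreal" where
  "ennreal_powr x p = (if x = top then top else ennreal (enn2real x powr p))"

text \<open>
  \<open>\<beta>\<close> is meant to be the exponent conjugate to \<open>\<theta>\<close>.  The identity is in \<^typ>\<open>ereal\<close>, with integrals
  in \<open>[0,\<infinity>]\<close>.  Its right-hand side is never \<open>\<infinity>\<close>, and \<open>\<phi> w\<^sub>0\<close> is finite, so the case \<open>s = 0\<close> forces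
  \<open>\<phi> (u t) < \<infinity>\<close>; as \<open>\<phi> > -\<infinity>\<close>, both integrals are then finite as well.
\<close>

definition max_slope_curve ::
  "real \<Rightarrow> real \<Rightarrow> 'a set \<Rightarrow> ('a \<Rightarrow> 'a \<Rightarrow> real) \<Rightarrow> ('a \<Rightarrow> ereal) \<Rightarrow> ('a \<Rightarrow> ennreal) \<Rightarrow>
     'a \<Rightarrow> (real \<Rightarrow> 'a) \<Rightarrow> bool" where
  "max_slope_curve \<theta> \<beta> M d \<phi> g w\<^sub>0 u \<longleftrightarrow>
     w\<^sub>0 \<in> eff_dom M \<phi> \<and> AC_loc_curve \<theta> {0..} M d u \<and> u 0 = w\<^sub>0 \<and>
     (\<forall>s t. 0 \<le> s \<and> s < t \<longrightarrow>
        \<phi> (u t) - \<phi> (u s) =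
          - (ereal (1 / \<beta>) * enn2ereal (\<integral>\<^sup>+ r\<in>{s..t}. ennreal_powr (g (u r)) \<beta> \<partial>lebesgue))
          - ereal (1 / \<theta>) *
              enn2ereal (\<integral>\<^sup>+ r\<in>{s..t}. ennreal (metric_deriv {0..} d u r powr \<theta>) \<partial>lebesgue))"

end

theory Submission
  imports Defs "HOL-Library.Diagonal_Subsequence"
begin

text \<open>
  Along a curve of maximal slope the energy identity bounds \<open>\<integral>|u'|\<^sup>\<theta>\<close> by the dissipated energy, which
  by (\<open>\<Phi>\<close>2) is at most affine in \<open>d\<^sub>0(u(t), u\<^sub>*)\<^sup>\<theta>\<close>; with Hoelder's inequality on short time steps this
  gives bounds for \<open>d\<^sub>0\<close> and for \<open>\<integral>|u'|\<^sup>\<theta>\<close> on \<open>[0,T]\<close> that are uniform in \<open>\<epsilon>\<close>.  Hence the curves are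
  equicontinuous for \<open>d\<^sub>0\<close>, and (\<open>\<Phi>\<close>3) with a diagonal argument yields \<open>\<sigma>\<close>-convergence at rational times,
  which lower semicontinuity of \<open>d\<^sub>0\<close> extends to all times.  Weak compactness in \<open>L\<^sup>\<theta>\<close> is avoided: the
  primitives of \<open>c\<^sub>0|u'|\<close> and \<open>(c\<^sub>0|u'|)\<^sup>\<theta>\<close> converge pointwise along the same subsequence, and Young's
  inequality between their increments passes to the limit, which makes the first limit
  absolutely continuous with density in \<open>L\<^sup>\<theta>\<close>.  The lower bound on the dissipation needs the metric
  derivative to exist almost everywhere.
\<close>

section \<open>Stieltjes measures of monotone functions\<close>

text \<open>For a fixed \<open>c\<close>, Young's inequality is linear in the increments of
  \<open>F\<close>, of \<open>G\<close> and of time. A linear inequality on intervals carries over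
  to Borel sets by additivity, which the power form of Hoelder's inequality does not; taking all
  \<open>c\<close> together loses nothing, since \<open>c = x / \<tau>\<close> gives Hoelder's
  inequality back. A pair \<open>F\<close>, \<open>G\<close> with this family of inequalities is
  therefore a substitute for a density in \<open>L\<^sup>\<theta>\<close>. It serves twice: for the
  limit of the curves, and for the distances from the moving point of one curve to fixed points of
  it, whose derivatives produce the metric derivative.

  Two obstacles shape the estimates. \<open>metric_deriv\<close> is unspecified where its limit does
  not exist, so the energy identity becomes usable only when the metric derivative is identified
  almost everywhere with a measurable density. And the lower bound (\<Phi>2) allows decay with the
  same power \<theta> that the dissipation controls: the distance reappears on the right with the
  same exponent, and can be absorbed only on time steps of a length fixed by the constants, not on
  \<open>[0,T]\<close> at once.\<close>

lemma borel_signed_eq_0: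
  fixes \<delta> :: "real set \<Rightarrow> real"
  assumes sums: "\<And>A :: nat \<Rightarrow> real set. range A \<subseteq> sets borel \<Longrightarrow> disjoint_family A \<Longrightarrow>
      (\<lambda>i. \<delta> (A i)) sums \<delta> (\<Union>i. A i)"
    and compl: "\<And>A. A \<in> sets borel \<Longrightarrow> \<delta> (- A) = \<delta> UNIV - \<delta> A"
    and univ: "\<delta> UNIV = 0" and Ioc: "\<And>a b. \<delta> {a<..b} = 0"
    and A: "A \<in> sets borel"
  shows "\<delta> A = 0"
proof -
  let ?E = "range (\<lambda>(i, j). {i<..j::real})"
  have borel_eq: "sets borel = sigma_sets UNIV ?E"
    by (simp add: borel_sigma_sets_Ioc)
  have "Int_stable ?E"
    unfolding Int_stable_def by (auto simp: image_iff)
  moreover have "?E \<subseteq> Pow UNIV" by simp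
  moreover have "A \<in> sigma_sets UNIV ?E"
    using A borel_eq by simp
  ultimately show ?thesis
  proof (induction rule: sigma_sets_induct_disjoint)
    case (basic X) then show ?case using Ioc by auto
  next
    case empty then show ?case using Ioc[of 1 0] by simp
  next
    case (compl X) then show ?case
      using assms(2)[of X] univ borel_eq by (simp add: Compl_eq_Diff_UNIV)
  next
    case (union X)
    then have "range X \<subseteq> sets borel" unfolding borel_eq by simp
    then have "(\<lambda>i. \<delta> (X i)) sums \<delta> (\<Union>i. X i)"
      by (rule sums) (rule union)
    moreover have "(\<lambda>i. \<delta> (X i)) sums 0"
      using union by (intro sums_0) simp
    ultimately show ?case by (rule sums_unique2)
  qed
qed

text \<open>\<open>measure\<close> returns 0 on sets of infinite mass, so on the whole line it is
  not additive for Lebesgue measure. Cutting with a window \<open>W\<close> of finite mass makes it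
  so, and differences of measures can be formed in the reals.\<close>

lemma measure_Int_window_sums:
  fixes W :: "real set"
  assumes "sets M = sets borel" "W \<in> sets borel" "emeasure M W \<noteq> \<infinity>"
    and "range A \<subseteq> sets borel" "disjoint_family A"
  shows "(\<lambda>i::nat. measure M (A i \<inter> W)) sums measure M ((\<Union>i. A i) \<inter> W)"
proof -
  have "(\<lambda>i. measure M (A i \<inter> W)) sums measure M (\<Union>i. A i \<inter> W)"
  proof (rule measure_UNION)
    show "range (\<lambda>i. A i \<inter> W) \<subseteq> sets M" using assms by auto
    show "disjoint_family (\<lambda>i. A i \<inter> W)"
      using assms(5) unfolding disjoint_family_on_def by blast
    have "emeasure M (\<Union>i. A i \<inter> W) \<le> emeasure M W"
      using assms by (intro emeasure_mono) auto
    then show "emeasure M (\<Union>i. A i \<inter> W) \<noteq> \<infinity>" using assms(3) by (auto simp: top_unique)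
  qed
  then show ?thesis by simp
qed

lemma measure_Int_window_compl:
  fixes W :: "real set"
  assumes "sets M = sets borel" "W \<in> sets borel" "emeasure M W \<noteq> \<infinity>" "A \<in> sets borel"
  shows "measure M (- A \<inter> W) = measure M (UNIV \<inter> W) - measure M (A \<inter> W)"
proof -
  have "emeasure M (A \<inter> W) \<le> emeasure M W" using assms by (intro emeasure_mono) auto
  then have "A \<inter> W \<in> fmeasurable M" "W \<in> fmeasurable M"
    using assms by (auto simp: fmeasurable_def top_unique less_top)
  then have "measure M (W - (A \<inter> W)) = measure M W - measure M (A \<inter> W)"
    by (intro measurable_measure_Diff) (auto simp: assms)
  moreover have "W - (A \<inter> W) = - A \<inter> W" by blast
  ultimately show ?thesis by simp
qed

text \<open>These are the conditions under which \<open>interval_measure F\<close> gives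
  \<open>{a<..b}\<close> the mass \<open>F b - F a\<close>. They concern the whole line, which is
  why curves and densities given on \<open>[0,\<infinity>)\<close> are extended to negative
  times.\<close>

definition right_cont_mono :: "(real \<Rightarrow> real) \<Rightarrow> bool" where
  "right_cont_mono F \<longleftrightarrow> mono F \<and> (\<forall>x. continuous (at_right x) F)"

lemma emeasure_right_cont_mono:
  assumes "right_cont_mono F"
  shows "emeasure (interval_measure F) {a<..b} = (if a \<le> b then ennreal (F b - F a) else 0)"
  using assms emeasure_interval_measure_Ioc_eq[of F a b]
  by (simp add: right_cont_mono_def mono_def)

text \<open>The hypothesis says that \<open>b * t + G t - a * F t\<close> is monotone, so this
  function has a Stieltjes measure of its own. On half-open intervals, hence on bounded Borel sets,
  that measure is the combination of the other three, and the claim is its nonnegativity.\<close>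

lemma interval_measure_comparison:
  assumes F: "right_cont_mono F" and G: "right_cont_mono G" and ab: "0 \<le> a" "0 \<le> b"
    and le: "\<And>s t. s \<le> t \<Longrightarrow> a * (F t - F s) \<le> b * (t - s) + (G t - G s)"
    and A: "A \<in> sets borel" "A \<subseteq> {l<..r}"
  shows "a * measure (interval_measure F) A
    \<le> b * measure lborel A + measure (interval_measure G) A"
proof -
  define H where "H = (\<lambda>t. b * t + G t - a * F t)"
  have H: "right_cont_mono H"
    unfolding right_cont_mono_def
  proof (intro conjI allI monoI)
    show "H s \<le> H t" if "s \<le> t" for s t
      using le[OF that] by (simp add: H_def algebra_simps)
    show "continuous (at_right x) H" for x
      using F G unfolding H_def right_cont_mono_def by (intro continuous_intros) auto
  qed
  let ?W = "{l<..r}"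
  \<comment> \<open>The window \<open>?W\<close> keeps all four measures finite. Since
    \<open>\<delta>\<close> vanishes on \<open>?W\<close> itself, its total mass is 0, which
    \<open>borel_signed_eq_0\<close> needs for complements.\<close>
  define \<delta> where "\<delta> = (\<lambda>A. b * measure lborel (A \<inter> ?W) + measure (interval_measure G) (A \<inter> ?W)
    - a * measure (interval_measure F) (A \<inter> ?W) - measure (interval_measure H) (A \<inter> ?W))"
  have fin: "emeasure (interval_measure K) ?W \<noteq> \<infinity>" if "right_cont_mono K" for K
    using that by (simp add: emeasure_right_cont_mono)
  have finL: "emeasure lborel ?W \<noteq> \<infinity>" by (cases "l \<le> r") auto
  have mIoc: "measure (interval_measure K) {x<..y} = (if x \<le> y then K y - K x else 0)"
    if "right_cont_mono K" for K x y
    using that by (simp add: measure_def emeasure_right_cont_mono right_cont_mono_def mono_def)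
  have mL: "measure lborel {x<..y} = (if x \<le> y then y - x else 0)" for x y :: real
    by simp
  have "\<delta> A = 0"
  proof (rule borel_signed_eq_0[OF _ _ _ _ A(1)])
    fix X :: "nat \<Rightarrow> real set" assume X: "range X \<subseteq> sets borel" "disjoint_family X"
    show "(\<lambda>i. \<delta> (X i)) sums \<delta> (\<Union>i. X i)"
      unfolding \<delta>_def
      by (intro sums_add sums_diff sums_mult measure_Int_window_sums X fin F G H finL) auto
  next
    fix X :: "real set" assume X: "X \<in> sets borel"
    show "\<delta> (- X) = \<delta> UNIV - \<delta> X"
      unfolding \<delta>_def using X fin[OF F] fin[OF G] fin[OF H] finL
      by (simp add: measure_Int_window_compl algebra_simps)
  next
    have Ioc: "\<delta> {x<..y} = 0" for x y
    proof -
      have "{x<..y} \<inter> ?W = {max x l<..min y r}" by auto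
      then show ?thesis
        by (cases "max x l \<le> min y r")
          (simp_all only: \<delta>_def mIoc[OF F] mIoc[OF G] mIoc[OF H] mL if_True if_False,
           simp_all add: H_def algebra_simps)
    qed
    show "\<delta> {x<..y} = 0" for x y by (rule Ioc)
    have "\<delta> UNIV = \<delta> ?W" by (simp add: \<delta>_def)
    then show "\<delta> UNIV = 0" using Ioc by simp
  qed
  moreover have AW: "A \<inter> ?W = A" using A by auto
  ultimately show ?thesis using measure_nonneg[of "interval_measure H" A]
    unfolding \<delta>_def AW by argo
qed

text \<open>With \<open>c\<close> such that \<open>p * c powr q * x = y + 1\<close>, the bound fails
  for every positive \<open>x\<close>.\<close>

lemma le_all_powr_imp_0:
  fixes x y p q :: real
  assumes "0 < p" "0 < q" "0 \<le> x" "0 \<le> y" and le: "\<And>c. 0 < c \<Longrightarrow> p * c powr q * x \<le> y"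
  shows "x = 0"
proof (rule ccontr)
  assume "x \<noteq> 0"
  then have x: "0 < x" using assms by simp
  let ?c = "((y + 1) / (p * x)) powr (1 / q)"
  have "0 < (y + 1) / (p * x)" using assms x by (intro divide_pos_pos mult_pos_pos) auto
  then have "?c powr q = (y + 1) / (p * x)" "0 < ?c"
    using assms by (auto simp: powr_powr simp del: powr_eq_0_iff)
  with le[of ?c] show False using x assms by (auto simp: field_simps)
qed

text \<open>
  By Young's inequality, the hypothesis is what \<open>F = \<integral>f\<close>, \<open>G = \<integral>f\<^sup>p\<close> satisfy; unlike that relation it
  survives pointwise limits of \<open>F\<close> and \<open>G\<close>.  Letting \<open>c \<rightarrow> \<infinity>\<close> shows that the measure of \<open>F\<close> vanishes
  on Lebesgue null sets, and taking \<open>c = k\<close> on \<open>{k \<le> h < k + 1}\<close> bounds \<open>\<integral>h\<^sup>p\<close> by the increments of \<open>G\<close>.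
\<close>

theorem Radon_Nikodym_powr:
  fixes F G :: "real \<Rightarrow> real"
  assumes p: "1 < p" and F: "right_cont_mono F" and G: "right_cont_mono G"
    and le: "\<And>c s t. 0 < c \<Longrightarrow> s \<le> t \<Longrightarrow>
      p * c powr (p - 1) * (F t - F s) \<le> (p - 1) * c powr p * (t - s) + (G t - G s)"
  obtains h where "h \<in> borel_measurable borel" "\<And>x. 0 \<le> h x"
    "\<And>s t. s \<le> t \<Longrightarrow> (h has_integral (F t - F s)) {s..t}"
    "\<And>s t. (\<lambda>x. h x powr p) integrable_on {s..t}"
proof -
  let ?F = "interval_measure F" and ?G = "interval_measure G"
  have comp: "p * c powr (p - 1) * measure ?F A \<le> (p - 1) * c powr p * measure lborel A + measure ?G A"
    if "0 < c" "A \<in> sets borel" "A \<subseteq> {l<..r}" for c A l r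
    using interval_measure_comparison[OF F G _ _ le[OF that(1)] that(2,3)] that p by simp
  have fin: "emeasure (interval_measure K) A < \<infinity>"
    if "right_cont_mono K" "A \<subseteq> {l<..r}" for K A l r
  proof -
    have "emeasure (interval_measure K) A \<le> emeasure (interval_measure K) {l<..r}"
      using that by (intro emeasure_mono) auto
    also have "\<dots> < \<infinity>" using that by (simp add: emeasure_right_cont_mono)
    finally show ?thesis .
  qed
  have "absolutely_continuous lborel ?F"
    unfolding absolutely_continuous_def
  proof
    fix N :: "real set" assume N: "N \<in> null_sets lborel"
    \<comment> \<open>\<open>comp\<close> speaks of bounded sets, hence the windows; there the mass
      of \<open>F\<close> is finite, so a vanishing \<open>measure\<close> means a null set.\<close>
    have "N \<inter> {- real n<..real n} \<in> null_sets ?F" for n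
    proof -
      let ?A = "N \<inter> {- real n<..real n}"
      have A: "?A \<in> sets borel" "?A \<subseteq> {- real n<..real n}" using N by (auto dest: null_setsD2)
      have "?A \<in> null_sets lborel" using N by (intro null_set_Int2) auto
      then have "measure lborel ?A = 0" by (simp add: null_sets_def measure_def)
      then have "p * c powr (p - 1) * measure ?F ?A \<le> measure ?G ?A" if "0 < c" for c
        using comp[OF that A] by simp
      then have "measure ?F ?A = 0"
        by (rule le_all_powr_imp_0[rotated 4]) (use p in auto)
      then have "emeasure ?F ?A = 0"
        using fin[OF F A(2)] by (simp add: emeasure_eq_ennreal_measure less_top)
      then show ?thesis using A by auto
    qed
    then have "(\<Union>n. N \<inter> {- real n<..real n}) \<in> null_sets ?F" by (intro null_sets_UN) auto
    moreover have "(\<Union>n. N \<inter> {- real n<..real n}) = N"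
    proof -
      have "\<exists>n. x \<in> {- real n<..real n}" for x :: real
      proof -
        obtain n where "\<bar>x\<bar> < real n" using reals_Archimedean2 by blast
        then show ?thesis by (intro exI[of _ n]) auto
      qed
      then show ?thesis by blast
    qed
    ultimately show "N \<in> null_sets ?F" by simp
  qed
  then obtain f where f[measurable]: "f \<in> borel_measurable lborel" and dens: "density lborel f = ?F"
    using sigma_finite_measure.Radon_Nikodym[OF sigma_finite_lborel, of ?F] by auto
  have nnF: "(\<integral>\<^sup>+x. f x * indicator A x \<partial>lborel) = emeasure ?F A" if "A \<in> sets borel" for A
    using that f by (simp add: dens[symmetric] emeasure_density)
  have fin_AE: "AE x in lborel. f x < \<infinity>"
  proof -
    have "AE x in lborel. f x * indicator {- real n<..real n} x \<noteq> \<infinity>" for n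
      using fin[OF F subset_refl, of "- real n" "real n"]
      by (intro nn_integral_PInf_AE) (auto simp: nnF)
    then have "AE x in lborel. \<forall>n. f x * indicator {- real n<..real n} x \<noteq> \<infinity>"
      by (simp add: AE_all_countable)
    then show ?thesis
    proof eventually_elim
      case (elim x)
      obtain n where "\<bar>x\<bar> < real n" using reals_Archimedean2 by blast
      then have "x \<in> {- real n<..real n}" by auto
      with elim[rule_format, of n] show ?case by (simp add: less_top)
    qed
  qed
  define h where "h = (\<lambda>x. enn2real (f x))"
  have h[measurable]: "h \<in> borel_measurable borel" using f by (simp add: h_def)
  have h0: "0 \<le> h x" for x by (simp add: h_def)
  have fh: "AE x in lborel. f x = ennreal (h x)"
    using fin_AE by eventually_elim (simp add: h_def)
  have nnh: "(\<integral>\<^sup>+x. ennreal (h x) * indicator A x \<partial>lborel) = emeasure ?F A" if "A \<in> sets borel" for A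
    unfolding nnF[OF that, symmetric] using fh by (intro nn_integral_cong_AE) auto
  have int: "(h has_integral (F t - F s)) {s..t}" if st: "s \<le> t" for s t
  proof -
    have "(\<integral>\<^sup>+x. ennreal (indicator {s..t} x * h x) \<partial>lborel)
        = (\<integral>\<^sup>+x. ennreal (h x) * indicator {s<..t} x \<partial>lborel)"
      using AE_lborel_singleton[of s]
      by (intro nn_integral_cong_AE, eventually_elim) (auto simp: indicator_def)
    also have "\<dots> = ennreal (F t - F s)" using st F by (simp add: nnh emeasure_right_cont_mono)
    finally have "((\<lambda>x. indicator {s..t} x * h x) has_integral (F t - F s)) UNIV"
      using F st h0 by (intro nn_integral_has_integral) (auto simp: right_cont_mono_def mono_def)
    then show ?thesis
      by (subst has_integral_restrict_UNIV[symmetric]) (auto elim!: has_integral_eq[rotated] simp: indicator_def)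
  qed
  have intp: "(\<lambda>x. h x powr p) integrable_on {s..t}" for s t
  proof -
    define k where "k = (\<lambda>x. nat \<lfloor>h x\<rfloor>)"
    have k[measurable]: "k \<in> borel \<rightarrow>\<^sub>M count_space UNIV" unfolding k_def by measurable
    define A where "A = (\<lambda>n. {x \<in> {s<..t}. k x = n})"
    have A[measurable]: "A n \<in> sets borel" for n unfolding A_def by measurable
    have Asub: "A n \<subseteq> {s<..t}" for n by (auto simp: A_def)
    have AL: "emeasure lborel (A n) < \<infinity>" for n
    proof -
      have "emeasure lborel (A n) \<le> emeasure lborel {s<..t}"
        using Asub by (intro emeasure_mono) auto
      also have "\<dots> < \<infinity>" by (cases "s \<le> t") auto
      finally show ?thesis .
    qed
    \<comment> \<open>On \<open>A n\<close> the density is at least \<open>n\<close>, so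
      \<open>n\<close> times the length of \<open>A n\<close> is at most its \<open>F\<close>-mass.
      Inserting this in the comparison with \<open>c = n\<close>, the factor \<open>p\<close> on the
      left exceeds \<open>p - 1\<close> on the right by one, and exactly \<open>n powr p\<close>
      times the length remains below the \<open>G\<close>-mass.\<close>
    have level: "ennreal (real n powr p) * emeasure lborel (A n) \<le> emeasure ?G (A n)" for n
    proof (cases "n = 0")
      case False
      have "ennreal (real n * measure lborel (A n)) = (\<integral>\<^sup>+x. ennreal (real n) * indicator (A n) x \<partial>lborel)"
        using AL[of n] by (simp add: nn_integral_cmult_indicator ennreal_mult emeasure_eq_ennreal_measure less_top)
      also have "\<dots> \<le> (\<integral>\<^sup>+x. ennreal (h x) * indicator (A n) x \<partial>lborel)"
      proof (intro nn_integral_mono)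
        fix x show "ennreal (real n) * indicator (A n) x \<le> ennreal (h x) * indicator (A n) x"
          using h0[of x] by (auto simp: A_def k_def indicator_def intro!: ennreal_leI)
      qed
      also have "\<dots> = ennreal (measure ?F (A n))"
        using fin[OF F Asub] by (simp add: nnh emeasure_eq_ennreal_measure less_top)
      finally have le1: "real n * measure lborel (A n) \<le> measure ?F (A n)"
        by simp
      have pow: "real n powr p = real n powr (p - 1) * real n"
        using False powr_add[of "real n" "p - 1" 1] by simp
      have "p * real n powr (p - 1) * (real n * measure lborel (A n)) \<le> p * real n powr (p - 1) * measure ?F (A n)"
        using le1 p by (intro mult_left_mono) auto
      also have "\<dots> \<le> (p - 1) * real n powr p * measure lborel (A n) + measure ?G (A n)"
        using comp[OF _ A Asub, of "real n"] False by simp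
      finally have "real n powr p * measure lborel (A n) \<le> measure ?G (A n)"
        by (simp add: pow algebra_simps)
      then show ?thesis
        using AL[of n] fin[OF G Asub, of n]
        by (simp add: emeasure_eq_ennreal_measure less_top flip: ennreal_mult')
    qed simp
    let ?k = "\<lambda>x. real (k x) powr p"
    have "(\<integral>\<^sup>+x. ennreal (indicator {s<..t} x * ?k x) \<partial>lborel)
        = (\<integral>\<^sup>+x. (\<Sum>n. ennreal (real n powr p) * indicator (A n) x) \<partial>lborel)"
    proof (intro nn_integral_cong)
      fix x
      have "(\<Sum>n. ennreal (real n powr p) * indicator (A n) x)
          = (\<Sum>n\<in>{k x}. ennreal (real n powr p) * indicator (A n) x)"
        by (rule suminf_finite) (auto simp: A_def)
      then show "ennreal (indicator {s<..t} x * ?k x) = (\<Sum>n. ennreal (real n powr p) * indicator (A n) x)"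
        by (auto simp: A_def indicator_def)
    qed
    also have "\<dots> = (\<Sum>n. ennreal (real n powr p) * emeasure lborel (A n))"
      by (simp add: nn_integral_suminf nn_integral_cmult_indicator)
    also have "\<dots> \<le> (\<Sum>n. emeasure ?G (A n))"
      by (intro suminf_le level) auto
    also have "\<dots> = emeasure ?G (\<Union>n. A n)"
      by (intro suminf_emeasure) (auto simp: disjoint_family_on_def A_def)
    also have "\<dots> < \<infinity>" using Asub by (intro fin[OF G]) blast
    finally have "integrable lborel (\<lambda>x. indicator {s<..t} x * ?k x)"
      by (intro integrableI_nonneg) auto
    moreover have "integrable lborel (\<lambda>x. indicator {s<..t} x :: real)"
      by (cases "s \<le> t") auto
    ultimately have "integrable lborel (\<lambda>x. 2 powr p * (indicator {s<..t} x + indicator {s<..t} x * ?k x))"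
      by simp
    then have "integrable lborel (\<lambda>x. indicator {s<..t} x *\<^sub>R (h x powr p))"
    proof (rule Bochner_Integration.integrable_bound)
      show "AE x in lborel. norm (indicator {s<..t} x *\<^sub>R (h x powr p))
          \<le> norm (2 powr p * (indicator {s<..t} x + indicator {s<..t} x * ?k x))"
      proof (intro AE_I2)
        fix x
        \<comment> \<open>Since \<open>h x < k x + 1\<close>, the value \<open>h x\<close> is at
          most 2 if \<open>k x = 0\<close> and at most \<open>2 * k x\<close> otherwise.\<close>
        have "h x powr p \<le> 2 powr p * (1 + ?k x)"
        proof (cases "k x = 0")
          case True
          then have "h x \<le> 2" using h0[of x] unfolding k_def by linarith
          then show ?thesis using True p h0[of x] by (simp add: powr_mono2)
        next
          case False
          then have "h x \<le> 2 * real (k x)" using h0[of x] unfolding k_def by linarith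
          then have "h x powr p \<le> (2 * real (k x)) powr p" using h0[of x] p by (intro powr_mono2) auto
          also have "\<dots> = 2 powr p * ?k x" by (simp add: powr_mult)
          finally show ?thesis unfolding distrib_left using powr_ge_zero[of 2 p] by linarith
        qed
        then show "norm (indicator {s<..t} x *\<^sub>R (h x powr p))
          \<le> norm (2 powr p * (indicator {s<..t} x + indicator {s<..t} x * ?k x))"
          by (auto simp: indicator_def)
      qed
    qed measurable
    then have "(\<lambda>x. h x powr p) integrable_on {s<..t}"
      by (intro set_borel_integral_eq_integral(1)) (simp add: set_integrable_def)
    then show ?thesis
      by (rule integrable_spike_set) (auto intro!: negligible_subset[OF negligible_sing[of s]])
  qed
  show thesis using that[OF h h0 int intp] .
qed

section \<open>Differentiation of integrals\<close>

lemma right_Lebesgue_differentiation: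
  fixes f :: "real \<Rightarrow> real"
  assumes "\<And>a b. f integrable_on {a..b}"
  obtains N where "negligible N"
    "\<And>x. x \<notin> N \<Longrightarrow> ((\<lambda>h. integral {x..x + h} f / h) \<longlongrightarrow> f x) (at_right 0)"
proof -
  obtain N where N: "negligible N" and *: "\<And>x e. \<lbrakk>x \<notin> N; 0 < e\<rbrakk> \<Longrightarrow>
      \<exists>d>0. \<forall>h. 0 < h \<and> h < d \<longrightarrow> norm (integral (cbox x (x + h *\<^sub>R One)) f /\<^sub>R h ^ DIM(real) - f x) < e"
    using integrable_ccontinuous_explicit[of f] assms by (metis box_real(2))
  have "((\<lambda>h. integral {x..x + h} f / h) \<longlongrightarrow> f x) (at_right 0)" if "x \<notin> N" for x
  proof (rule tendstoI)
    fix e :: real assume "0 < e"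
    from *[OF that this] obtain d where "0 < d"
      "\<And>h. 0 < h \<Longrightarrow> h < d \<Longrightarrow> \<bar>integral {x..x + h} f / h - f x\<bar> < e"
      by (auto simp: divide_inverse_commute)
    then show "\<forall>\<^sub>F h in at_right 0. dist (integral {x..x + h} f / h) (f x) < e"
      by (auto simp: eventually_at_right_field dist_real_def)
  qed
  with N that show thesis by blast
qed

lemma AE_lebesgueI_negligible:
  assumes "negligible N" "\<And>x. x \<notin> N \<Longrightarrow> P x"
  shows "AE x in lebesgue. P x"
  using assms by (intro AE_I'[of N]) (auto simp: negligible_iff_null_sets)

text \<open>Left-hand difference quotients at \<open>x\<close> are, up to sign, right-hand ones of a
  primitive of the reflected function at \<open>- x\<close>. The one-sided statement is therefore
  applied twice, and the second exceptional set enters as its mirror image.\<close>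

theorem Lebesgue_differentiation:
  fixes f F :: "real \<Rightarrow> real"
  assumes int: "\<And>s t. s \<le> t \<Longrightarrow> (f has_integral (F t - F s)) {s..t}"
  shows "AE x in lebesgue. (F has_real_derivative f x) (at x)"
proof -
  have f: "f integrable_on {a..b}" for a b
    using int[of a b] by (cases "a \<le> b") (auto simp: has_integral_integrable)
  have g: "(\<lambda>x. f (- x)) integrable_on {a..b}" for a b
    using f[of "-b" "-a"] Henstock_Kurzweil_Integration.integrable_reflect_real[where f = f and a = "-b" and b = "-a"] by simp
  obtain N where N: "negligible N"
    "\<And>x. x \<notin> N \<Longrightarrow> ((\<lambda>h. integral {x..x + h} f / h) \<longlongrightarrow> f x) (at_right 0)"
    using right_Lebesgue_differentiation[OF f] by blast
  obtain N' where N': "negligible N'"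
    "\<And>x. x \<notin> N' \<Longrightarrow> ((\<lambda>h. integral {x..x + h} (\<lambda>x. f (- x)) / h) \<longlongrightarrow> f (- x)) (at_right 0)"
    using right_Lebesgue_differentiation[OF g] by blast
  have "negligible (N \<union> uminus ` N')"
    using N(1) N'(1) by (intro negligible_Un negligible_differentiable_image_negligible) (auto intro!: derivative_intros)
  then show ?thesis
  proof (rule AE_lebesgueI_negligible)
    fix x assume "x \<notin> N \<union> uminus ` N'"
    then have x: "x \<notin> N" "- x \<notin> N'" by force+
    have "((\<lambda>h. (F (x + h) - F x) / h) \<longlongrightarrow> f x) (at_right 0)"
    proof (rule Lim_transform_eventually[OF N(2)[OF x(1)]])
      show "\<forall>\<^sub>F h in at_right 0. integral {x..x + h} f / h = (F (x + h) - F x) / h"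
        using eventually_at_right_less[of "0::real"]
        by eventually_elim (simp add: integral_unique[OF int])
    qed
    moreover have "((\<lambda>h. (F (x + h) - F x) / h) \<longlongrightarrow> f x) (at_left 0)"
      unfolding filterlim_at_left_to_right
    proof -
      have "((\<lambda>h. integral {- x..- x + h} (\<lambda>x. f (- x)) / h) \<longlongrightarrow> f x) (at_right 0)"
        using N'(2)[OF x(2)] by simp
      then have "((\<lambda>h. (F (x + - h) - F x) / - h) \<longlongrightarrow> f x) (at_right 0)"
      proof (rule Lim_transform_eventually)
        show "\<forall>\<^sub>F h in at_right 0. integral {- x..- x + h} (\<lambda>x. f (- x)) / h = (F (x + - h) - F x) / - h"
          using eventually_at_right_less[of "0::real"]
        proof eventually_elim
          case (elim h)
          have "integral {- x..- (x - h)} (\<lambda>x. f (- x)) = integral {x - h..x} f"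
            by (rule Henstock_Kurzweil_Integration.integral_reflect_real)
          also have "\<dots> = F x - F (x - h)" using elim by (intro integral_unique int) simp
          finally have "integral {- x..- x + h} (\<lambda>x. f (- x)) = F x - F (x - h)" by (simp add: algebra_simps)
          then show ?case using elim by (simp add: field_simps)
        qed
      qed
      then show "((\<lambda>h. (F (x + - h) - F x) / - h) \<longlongrightarrow> f x) (at_right (- 0))" by simp
    qed
    ultimately have "((\<lambda>h. (F (x + h) - F x) / h) \<longlongrightarrow> f x) (at 0)"
      by (simp add: filterlim_split_at)
    then show "(F has_real_derivative f x) (at x)" by (simp add: DERIV_def)
  qed
qed

section \<open>Young's inequality for densities, primitives based at 0 and extension by zero\<close>

lemma Young_powr:
  fixes p c x :: real
  assumes "1 < p" "0 < c" "0 \<le> x"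
  shows "p * c powr (p - 1) * x \<le> (p - 1) * c powr p + x powr p"
proof (cases "x = 0")
  case False
  \<comment> \<open>Young's inequality for \<open>x powr p\<close> and \<open>c powr p\<close> with
    weights \<open>1 / p\<close> and \<open>1 - 1 / p\<close>. Multiplied by \<open>p\<close> it
    says that the tangent of \<open>x powr p\<close> at \<open>c\<close> lies below the
    graph.\<close>
  then have "(x powr p) powr (1 / p) * (c powr p) powr (1 - 1 / p)
      \<le> 1 / p * x powr p + (1 - 1 / p) * c powr p"
    using assms by (intro Youngs_inequality_0) auto
  moreover have "p * (1 - 1 / p) = p - 1" using assms by (simp add: field_simps)
  ultimately have "x * c powr (p - 1) \<le> 1 / p * x powr p + (1 - 1 / p) * c powr p"
    using assms by (simp add: powr_powr)
  then have "p * (x * c powr (p - 1)) \<le> p * (1 / p * x powr p + (1 - 1 / p) * c powr p)"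
    using assms by (intro mult_left_mono) auto
  also have "\<dots> = x powr p + (p * (1 - 1 / p)) * c powr p"
    using assms by (simp add: distrib_left)
  finally show ?thesis
    using \<open>p * (1 - 1 / p) = p - 1\<close> by (simp add: algebra_simps)
qed (use assms in auto)

lemma Young_has_integral:
  fixes f :: "real \<Rightarrow> real"
  assumes "1 < p" "0 < c" "s \<le> t" and f: "\<And>x. 0 \<le> f x"
    and "(f has_integral a) {s..t}" "((\<lambda>x. f x powr p) has_integral b) {s..t}"
  shows "p * c powr (p - 1) * a \<le> (p - 1) * c powr p * (t - s) + b"
proof (rule has_integral_le)
  show "((\<lambda>x. p * c powr (p - 1) * f x) has_integral p * c powr (p - 1) * a) {s..t}"
    using assms by (intro has_integral_mult_right)
  show "((\<lambda>x. (p - 1) * c powr p + f x powr p) has_integral (p - 1) * c powr p * (t - s) + b) {s..t}"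
    using assms has_integral_const_real[of "(p - 1) * c powr p" s t]
    by (intro has_integral_add) (auto simp: mult.commute)
qed (use Young_powr[OF assms(1,2)] f in auto)

text \<open>For \<open>t < 0\<close> the interval \<open>{0..t}\<close> is empty and its integral is
  0. Since \<open>f\<close> vanishes there too, the primitive based at 0 is correct on the whole
  line.\<close>

lemma has_integral_indefinite:
  fixes f :: "real \<Rightarrow> real"
  assumes f: "\<And>a b. f integrable_on {a..b}" and f0: "\<And>x. x < 0 \<Longrightarrow> f x = 0" and "s \<le> t"
  shows "(f has_integral (integral {0..t} f - integral {0..s} f)) {s..t}"
proof -
  have neg: "integral {a..b} f = 0" if "b \<le> 0" for a b
  proof -
    have "integral {a..b} f = integral {a..b} (\<lambda>x. 0)"
      using that by (intro integral_spike[OF negligible_sing[of 0]]) (auto simp: f0)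
    then show ?thesis by simp
  qed
  have "integral {s..t} f = integral {0..t} f - integral {0..s} f"
  proof (cases "0 \<le> s")
    case True
    then show ?thesis
      using Henstock_Kurzweil_Integration.integral_combine[of 0 s t f] f \<open>s \<le> t\<close> by simp
  next
    case False
    then show ?thesis
      using Henstock_Kurzweil_Integration.integral_combine[of s 0 t f] f \<open>s \<le> t\<close> neg[of 0 s] neg[of t s] neg[of t 0] neg[of s 0]
      by (cases "0 \<le> t") auto
  qed
  then show ?thesis using f[of s t] by (simp add: has_integral_integrable_integral)
qed

lemma continuous_on_antiderivative:
  fixes f F :: "real \<Rightarrow> real"
  assumes int: "\<And>s t. s \<le> t \<Longrightarrow> (f has_integral (F t - F s)) {s..t}"
  shows "continuous_on UNIV F"
proof -
  have "isCont F x" for x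
  proof -
    have "f integrable_on {x - 1..x + 1}" using int[of "x - 1" "x + 1"] by auto
    then have "continuous_on {x - 1..x + 1} (\<lambda>t. F (x - 1) + integral {x - 1..t} f)"
      by (intro continuous_intros indefinite_integral_continuous_1)
    then have "continuous_on {x - 1..x + 1} F"
      by (rule continuous_on_eq) (auto simp: integral_unique[OF int])
    then show ?thesis
      by (rule continuous_on_interior) auto
  qed
  then show ?thesis by (simp add: continuous_at_imp_continuous_on)
qed

lemma right_cont_mono_antiderivative:
  fixes f F :: "real \<Rightarrow> real"
  assumes int: "\<And>s t. s \<le> t \<Longrightarrow> (f has_integral (F t - F s)) {s..t}" and f: "\<And>x. 0 \<le> f x"
  shows "right_cont_mono F"
  unfolding right_cont_mono_def
proof (intro conjI monoI allI)
  show "F s \<le> F t" if "s \<le> t" for s t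
    using has_integral_nonneg[OF int[OF that]] f by simp
  have "isCont F x" for x
    using continuous_on_antiderivative[OF int] by (simp add: continuous_on_eq_continuous_at)
  then show "continuous (at_right x) F" for x
    by (simp add: continuous_at_imp_continuous_at_within)
qed

text \<open>Extended by zero, the density has primitives on the whole line, as Stieltjes measures
  require; the absolute value makes them monotone.\<close>

lemma Lp_loc_extension:
  assumes p: "1 < p" and m: "Lp_loc_on p {0..} m"
  defines "m0 \<equiv> \<lambda>x. if 0 \<le> x then \<bar>m x\<bar> else 0"
  shows "m0 \<in> borel_measurable lebesgue" and "m0 integrable_on {a..b}"
    and "(\<lambda>x. m0 x powr p) integrable_on {a..b}"
    and "0 \<le> s \<Longrightarrow> s \<le> t \<Longrightarrow> set_lebesgue_integral lebesgue {s..t} m \<le> integral {s..t} m0"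
proof -
  have Lp: "set_borel_measurable lebesgue {s..t} m" "(\<lambda>x. \<bar>m x\<bar> powr p) absolutely_integrable_on {s..t}"
    if "0 \<le> s" for s t
    using m that unfolding Lp_loc_on_def Lp_on_def by auto
  have abs: "m absolutely_integrable_on {s..t}" if "0 \<le> s" for s t
  proof (rule set_integrable_bound)
    show "(\<lambda>x. 1 + \<bar>m x\<bar> powr p) absolutely_integrable_on {s..t}"
      using Lp(2)[OF that] by (intro set_integral_add(1)) auto
    show "AE x in lebesgue. x \<in> {s..t} \<longrightarrow> norm (m x) \<le> norm (1 + \<bar>m x\<bar> powr p)"
    proof (intro AE_I2 impI)
      fix x
      have "\<bar>m x\<bar> \<le> 1 + \<bar>m x\<bar> powr p"
      proof (cases "\<bar>m x\<bar> \<le> 1")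
        case False
        then have "\<bar>m x\<bar> powr 1 \<le> \<bar>m x\<bar> powr p" using p by (intro powr_mono) auto
        then show ?thesis using False by simp
      qed (simp add: add_increasing2)
      then show "norm (m x) \<le> norm (1 + \<bar>m x\<bar> powr p)" by simp
    qed
  qed (use Lp that in auto)
  have Int: "{0..} \<inter> {a..b} = {max 0 a..b}" for a b :: real by auto
  have m0: "m0 = (\<lambda>x. if x \<in> {0..} then \<bar>m x\<bar> else 0)" by (auto simp: m0_def)
  show "m0 integrable_on {a..b}"
    unfolding m0 integrable_restrict_Int Int
    using set_integrable_abs[OF abs[of "max 0 a" b]] by (simp add: set_lebesgue_integral_eq_integral(1))
  have m0p: "(\<lambda>x. m0 x powr p) = (\<lambda>x. if x \<in> {0..} then \<bar>m x\<bar> powr p else 0)"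
    by (auto simp: m0_def)
  show "(\<lambda>x. m0 x powr p) integrable_on {a..b}"
    unfolding m0p integrable_restrict_Int Int
    using Lp(2)[of "max 0 a" b] by (simp add: set_lebesgue_integral_eq_integral(1))
  show "m0 \<in> borel_measurable lebesgue"
  \<comment> \<open>\<open>m\<close> is known to be measurable only on compact sets, so
    \<open>m0\<close> is obtained as the pointwise limit of its truncations.\<close>
  proof (rule borel_measurable_LIMSEQ_real)
    fix n show "(\<lambda>x. \<bar>indicator {0..real n} x *\<^sub>R m x\<bar>) \<in> borel_measurable lebesgue"
      using Lp(1)[of 0 "real n"] unfolding set_borel_measurable_def by (intro borel_measurable_abs) simp
  next
    fix x :: real
    obtain N where N: "\<bar>x\<bar> < real N" using reals_Archimedean2 by blast
    have "\<bar>indicator {0..real n} x *\<^sub>R m x\<bar> = m0 x" if "N \<le> n" for n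
      using N that by (auto simp: m0_def indicator_def)
    then show "(\<lambda>n. \<bar>indicator {0..real n} x *\<^sub>R m x\<bar>) \<longlonglongrightarrow> m0 x"
      by (intro tendsto_eventually) (auto simp: eventually_sequentially)
  qed
  show "set_lebesgue_integral lebesgue {s..t} m \<le> integral {s..t} m0" if st: "0 \<le> s" "s \<le> t"
  proof -
    have "set_lebesgue_integral lebesgue {s..t} m \<le> set_lebesgue_integral lebesgue {s..t} (\<lambda>x. \<bar>m x\<bar>)"
      using abs[OF st(1)] by (intro set_integral_mono set_integrable_abs) auto
    also have "\<dots> = integral {s..t} (\<lambda>x. \<bar>m x\<bar>)"
      using abs[OF st(1)] by (intro set_lebesgue_integral_eq_integral set_integrable_abs)
    also have "\<dots> = integral {s..t} m0"
      using st by (intro integral_cong) (auto simp: m0_def)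
    finally show ?thesis .
  qed
qed

section \<open>Metric derivative\<close>

lemma eventually_at_exceeds:
  fixes f :: "real \<Rightarrow> real"
  assumes "(f has_real_derivative D) (at x)" "a < \<bar>D\<bar>"
  shows "\<forall>\<^sub>F y in at x. a < \<bar>f y - f x\<bar> / \<bar>y - x\<bar>"
proof -
  have "((\<lambda>y. \<bar>(f y - f x) / (y - x)\<bar>) \<longlongrightarrow> \<bar>D\<bar>) (at x)"
    using assms(1) unfolding has_field_derivative_iff by (rule tendsto_rabs)
  then have "\<forall>\<^sub>F y in at x. a < \<bar>(f y - f x) / (y - x)\<bar>"
    using assms(2) by (rule order_tendstoD)
  then show ?thesis by (simp add: abs_divide)
qed

lemma eventually_at_below:
  fixes f :: "real \<Rightarrow> real"
  assumes "(f has_real_derivative D) (at x)" "\<bar>D\<bar> < a"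
  shows "\<forall>\<^sub>F y in at x. \<bar>f y - f x\<bar> / \<bar>y - x\<bar> < a"
proof -
  have "((\<lambda>y. \<bar>(f y - f x) / (y - x)\<bar>) \<longlongrightarrow> \<bar>D\<bar>) (at x)"
    using assms(1) unfolding has_field_derivative_iff by (rule tendsto_rabs)
  then have "\<forall>\<^sub>F y in at x. \<bar>(f y - f x) / (y - x)\<bar> < a"
    using assms(2) by (rule order_tendstoD)
  then show ?thesis by (simp add: abs_divide)
qed

lemma derivative_le_derivative:
  fixes f g :: "real \<Rightarrow> real"
  assumes f: "(f has_real_derivative D) (at x)" and g: "(g has_real_derivative E) (at x)"
    and le: "\<And>y. \<bar>f y - f x\<bar> \<le> \<bar>g y - g x\<bar>"
  shows "\<bar>D\<bar> \<le> \<bar>E\<bar>"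
proof (rule tendsto_le)
  show "((\<lambda>y. \<bar>(f y - f x) / (y - x)\<bar>) \<longlongrightarrow> \<bar>D\<bar>) (at x)"
    "((\<lambda>y. \<bar>(g y - g x) / (y - x)\<bar>) \<longlongrightarrow> \<bar>E\<bar>) (at x)"
    using f g unfolding has_field_derivative_iff by (auto intro!: tendsto_rabs simp del: abs_divide)
  show "\<forall>\<^sub>F y in at x. \<bar>(f y - f x) / (y - x)\<bar> \<le> \<bar>(g y - g x) / (y - x)\<bar>"
    using le by (simp add: abs_divide divide_right_mono)
qed simp

text \<open>
  The density is the supremum of \<open>\<bar>d/dt d (u t) (u q)\<bar>\<close> over rational \<open>q\<close>: it bounds \<open>d (u s) (u t)\<close> by
  letting \<open>q \<rightarrow> t\<close>, and each of its members bounds the difference quotient of \<open>u\<close> from below.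
\<close>

theorem metric_deriv_density:
  assumes M: "Metric_space M d" and p: "1 < p" and u: "AC_loc_curve p {0..} M d u"
  obtains n where "n \<in> borel_measurable lebesgue" "\<And>x. 0 \<le> n x" "\<And>x. x < 0 \<Longrightarrow> n x = 0"
    "\<And>a b. n integrable_on {a..b}" "\<And>a b. (\<lambda>x. n x powr p) integrable_on {a..b}"
    "\<And>s t. 0 \<le> s \<Longrightarrow> s \<le> t \<Longrightarrow> d (u s) (u t) \<le> integral {s..t} n"
    "AE t in lebesgue. 0 < t \<longrightarrow> metric_deriv {0..} d u t = n t"
proof -
  interpret Metric_space M d by (rule M)
  from u obtain m where uM: "u ` {0..} \<subseteq> M" and m: "Lp_loc_on p {0..} m"
    and um: "\<And>s t. 0 \<le> s \<Longrightarrow> s < t \<Longrightarrow> d (u s) (u t) \<le> set_lebesgue_integral lebesgue {s..t} m"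
    unfolding AC_loc_curve_def by auto
  define m0 where "m0 = (\<lambda>x. if 0 \<le> x then \<bar>m x\<bar> else 0)"
  have ext: "m0 \<in> borel_measurable lebesgue" "m0 integrable_on {a..b}"
    "(\<lambda>x. m0 x powr p) integrable_on {a..b}"
    "0 \<le> s \<Longrightarrow> s \<le> t \<Longrightarrow> set_lebesgue_integral lebesgue {s..t} m \<le> integral {s..t} m0" for a b s t
    unfolding m0_def by (fact Lp_loc_extension[OF p m])+
  have m0: "0 \<le> m0 x" "x < 0 \<Longrightarrow> m0 x = 0" for x by (auto simp: m0_def)
  define H where "H = (\<lambda>t. integral {0..t} m0)"
  have H: "(m0 has_integral (H t - H s)) {s..t}" if "s \<le> t" for s t
    unfolding H_def by (rule has_integral_indefinite[OF ext(2) m0(2) that])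
  \<comment> \<open>The factor 2 is for the functions \<open>F i\<close> below, whose increments are
    at most twice those of \<open>H\<close>.\<close>
  define G where "G = (\<lambda>t. integral {0..t} (\<lambda>x. (2 * m0 x) powr p))"
  have G: "((\<lambda>x. (2 * m0 x) powr p) has_integral (G t - G s)) {s..t}" if "s \<le> t" for s t
    unfolding G_def
  proof (rule has_integral_indefinite[OF _ _ that])
    fix a b
    have "(\<lambda>x. 2 powr p * m0 x powr p) integrable_on {a..b}"
      using integrable_cmul[OF ext(3), of "2 powr p" a b] by simp
    then show "(\<lambda>x. (2 * m0 x) powr p) integrable_on {a..b}" by (simp add: powr_mult m0)
  qed (simp add: m0)
  \<comment> \<open>The curve is frozen at its initial point for negative times, where
    \<open>H\<close> is constant as well.\<close>
  define U where "U = (\<lambda>t. u (max 0 t))"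
  have UM[simp]: "U t \<in> M" for t using uM by (auto simp: U_def)
  have UH: "d (U s) (U t) \<le> H t - H s" if "s \<le> t" for s t
  proof -
    have H0: "H (max 0 t) = H t" for t
    proof (cases "0 \<le> t")
      case False
      then show ?thesis by (simp add: H_def)
    qed (simp add: max_def)
    have "d (U s) (U t) \<le> H (max 0 t) - H (max 0 s)"
    proof (cases "max 0 s = max 0 t")
      case False
      then have lt: "max 0 s < max 0 t" using that by auto
      have "d (U s) (U t) \<le> integral {max 0 s..max 0 t} m0"
        unfolding U_def by (rule order_trans[OF um[OF _ lt] ext(4)]) (use lt in auto)
      also have "\<dots> = H (max 0 t) - H (max 0 s)" using lt by (intro integral_unique H) simp
      finally show ?thesis .
    next
      case True
      then have "U s = U t" by (simp add: U_def)
      with True show ?thesis by simp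
    qed
    then show ?thesis by (simp add: H0)
  qed
  have UH': "d (U s) (U t) \<le> \<bar>H t - H s\<bar>" for s t
    using UH[of s t] UH[of t s] commute[of "U s" "U t"] by (cases "s \<le> t") auto
  define q where "q = (\<lambda>i. from_nat_into (\<rat> :: real set) i)"
  have q: "\<exists>i. a < q i \<and> q i < b" if ab: "a < b" for a b :: real
  proof -
    obtain r where "r \<in> \<rat>" "a < r" "r < b" using Rats_dense_in_real[OF ab] by blast
    then show ?thesis
      using from_nat_into_surj[OF countable_rat, of r] by (auto simp: q_def)
  qed
  define \<psi> where "\<psi> = (\<lambda>i t. d (U t) (U (q i)))"
  have \<psi>U: "\<bar>\<psi> i t - \<psi> i s\<bar> \<le> d (U s) (U t)" for i s t
    using triangle[of "U s" "U t" "U (q i)"] triangle[of "U t" "U s" "U (q i)"] commute[of "U s" "U t"]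
    by (simp add: \<psi>_def abs_le_iff)
  have \<psi>H: "\<bar>\<psi> i t - \<psi> i s\<bar> \<le> H t - H s" if "s \<le> t" for i s t
    using \<psi>U[of i t s] UH[OF that] by simp
  have Hmono: "H s \<le> H t" if "s \<le> t" for s t
    using has_integral_nonneg[OF H[OF that]] m0 by simp
  \<comment> \<open>\<open>\<psi> i\<close> need not be monotone, but its increments are bounded by
    those of \<open>H\<close>. Adding \<open>H\<close> makes it monotone; the density
    \<open>m0\<close> of \<open>H\<close> is subtracted again in \<open>k\<close>.\<close>
  define F where "F = (\<lambda>i t. \<psi> i t + H t)"
  have Hcont: "isCont H x" for x
    using continuous_on_antiderivative[OF H] by (simp add: continuous_on_eq_continuous_at)
  have F: "right_cont_mono (F i)" for i
    unfolding right_cont_mono_def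
  proof (intro conjI allI monoI)
    show "F i s \<le> F i t" if "s \<le> t" for s t
      using \<psi>H[OF that, of i] by (simp add: F_def abs_le_iff)
    fix x
    have "((\<lambda>y. \<psi> i y - \<psi> i x) \<longlongrightarrow> 0) (at x)"
    proof (rule Lim_null_comparison)
      show "\<forall>\<^sub>F y in at x. norm (\<psi> i y - \<psi> i x) \<le> \<bar>H y - H x\<bar>"
      proof (intro always_eventually allI)
        fix y show "norm (\<psi> i y - \<psi> i x) \<le> \<bar>H y - H x\<bar>"
          using \<psi>U[of i y x] UH'[of x y] by simp
      qed
      show "((\<lambda>y. \<bar>H y - H x\<bar>) \<longlongrightarrow> 0) (at x)"
        using Hcont[of x] unfolding isCont_def by (intro tendsto_rabs_zero) (simp add: LIM_zero)
    qed
    then have "isCont (\<psi> i) x" unfolding isCont_def by (rule LIM_zero_cancel)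
    then have "isCont (F i) x" unfolding F_def using Hcont by (intro continuous_intros)
    then show "continuous (at_right x) (F i)" by (rule continuous_at_imp_continuous_at_within)
  qed
  have "\<exists>f. f \<in> borel_measurable borel \<and> (\<forall>s t. s \<le> t \<longrightarrow> (f has_integral (F i t - F i s)) {s..t})" for i
  proof (rule Radon_Nikodym_powr[OF p F right_cont_mono_antiderivative[OF G]])
    fix c s t :: real assume c: "0 < c" and st: "s \<le> t"
    have "F i t - F i s \<le> 2 * (H t - H s)"
      using \<psi>H[OF st, of i] by (simp add: F_def abs_le_iff)
    then have "p * c powr (p - 1) * (F i t - F i s) \<le> p * c powr (p - 1) * (2 * (H t - H s))"
      using p by (intro mult_left_mono) auto
    also have "\<dots> \<le> (p - 1) * c powr p * (t - s) + (G t - G s)"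
      using c st p m0 by (intro Young_has_integral[OF _ _ _ _ _ G] has_integral_mult_right H) auto
    finally show "p * c powr (p - 1) * (F i t - F i s) \<le> (p - 1) * c powr p * (t - s) + (G t - G s)" .
  qed (auto simp: m0)
  then obtain f where f: "\<And>i. f i \<in> borel_measurable borel"
    "\<And>i s t. s \<le> t \<Longrightarrow> (f i has_integral (F i t - F i s)) {s..t}"
    by metis
  define k where "k = (\<lambda>i x. f i x - m0 x)"
  have k: "(k i has_integral (\<psi> i t - \<psi> i s)) {s..t}" if "s \<le> t" for i s t
    using has_integral_diff[OF f(2)[OF that, of i] H[OF that]] by (simp add: k_def F_def)
  \<comment> \<open>The minimum with \<open>m0\<close> keeps the supremum finite at every point. By
    \<open>km\<close> it changes nothing outside the null set \<open>Z\<close>.\<close>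
  define n where "n = (\<lambda>x. SUP i. min \<bar>k i x\<bar> (m0 x))"
  have bdd: "bdd_above (range (\<lambda>i. min \<bar>k i x\<bar> (m0 x)))" for x
    by (rule bdd_aboveI[of _ "m0 x"]) auto
  have n0: "0 \<le> n x" for x
    unfolding n_def using m0(1)[of x] by (intro cSUP_upper2[OF bdd, where x = 0]) simp_all
  have nm: "n x \<le> m0 x" for x
    unfolding n_def by (rule cSUP_least) auto
  have nneg: "n x = 0" if "x < 0" for x using n0[of x] nm[of x] m0(2)[OF that] by simp
  have n_meas[measurable]: "n \<in> borel_measurable lebesgue"
  proof -
    have "f i \<in> borel_measurable lebesgue" for i using f(1) by (intro measurable_completion) simp
    then have "k i \<in> borel_measurable lebesgue" for i
      unfolding k_def using ext(1) by (intro borel_measurable_diff)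
    then show ?thesis unfolding n_def using ext(1)
      by (intro borel_measurable_cSUP bdd borel_measurable_min borel_measurable_abs) auto
  qed
  have n_int: "n integrable_on {a..b}" for a b
    using n_meas ext(2)[of a b] n0 nm
    by (intro measurable_bounded_by_integrable_imp_integrable[of n "{a..b}" m0])
      (auto intro: measurable_restrict_space1)
  have np_int: "(\<lambda>x. n x powr p) integrable_on {a..b}" for a b
  proof (rule measurable_bounded_by_integrable_imp_integrable[OF _ ext(3)])
    show "(\<lambda>x. n x powr p) \<in> borel_measurable (lebesgue_on {a..b})"
      by (intro measurable_restrict_space1) measurable
  qed (use n0 nm p in \<open>auto intro!: powr_mono2\<close>)
  define N where "N = (\<lambda>t. integral {0..t} n)"
  have N: "(n has_integral (N t - N s)) {s..t}" if "s \<le> t" for s t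
    unfolding N_def by (rule has_integral_indefinite[OF n_int nneg that])
  have "AE x in lebesgue. (\<forall>i. (F i has_real_derivative f i x) (at x))
      \<and> (H has_real_derivative m0 x) (at x) \<and> (N has_real_derivative n x) (at x)"
    unfolding AE_conj_iff AE_all_countable
    using Lebesgue_differentiation[OF f(2)] Lebesgue_differentiation[OF H] Lebesgue_differentiation[OF N]
    by blast
  then obtain Z where Z: "Z \<in> null_sets lebesgue" and good: "\<And>x. x \<in> space lebesgue - Z \<Longrightarrow>
      (\<forall>i. (F i has_real_derivative f i x) (at x))
      \<and> (H has_real_derivative m0 x) (at x) \<and> (N has_real_derivative n x) (at x)"
    by (rule AE_E3) blast
  have Zneg: "negligible Z" using Z by (simp add: negligible_iff_null_sets)
  have Hd: "(H has_real_derivative m0 x) (at x)" and Nd: "(N has_real_derivative n x) (at x)"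
    and \<psi>d: "(\<psi> i has_real_derivative k i x) (at x)" if "x \<notin> Z" for x i
  proof -
    have *: "(F i has_real_derivative f i x) (at x)" "(H has_real_derivative m0 x) (at x)"
      "(N has_real_derivative n x) (at x)"
      using good[of x] that by auto
    then show "(H has_real_derivative m0 x) (at x)" "(N has_real_derivative n x) (at x)" by auto
    from DERIV_diff[OF *(1,2)] show "(\<psi> i has_real_derivative k i x) (at x)"
      by (simp add: F_def k_def)
  qed
  have km: "\<bar>k i x\<bar> \<le> m0 x" if "x \<notin> Z" for x i
  proof -
    have "\<bar>\<psi> i y - \<psi> i x\<bar> \<le> \<bar>H y - H x\<bar>" for y
      using \<psi>U[of i y x] UH'[of x y] by simp
    from derivative_le_derivative[OF \<psi>d[OF that] Hd[OF that] this] show ?thesis using m0(1)[of x] by simp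
  qed
  have kn: "\<bar>k i x\<bar> \<le> n x" if "x \<notin> Z" for x i
    unfolding n_def using km[OF that, of i] by (intro cSUP_upper2[OF bdd, where x = i]) auto
  have UN: "d (U s) (U t) \<le> N t - N s" if st: "s \<le> t" for s t
  proof (rule field_le_epsilon)
    fix e :: real assume e: "0 < e"
    have "isCont H t" by (rule Hcont)
    then obtain \<delta> where \<delta>: "0 < \<delta>" "\<And>y. \<bar>y - t\<bar> < \<delta> \<Longrightarrow> \<bar>H y - H t\<bar> < e / 2"
      using e unfolding continuous_at_eps_delta dist_real_def by (metis half_gt_zero)
    obtain i where i: "t - \<delta> < q i" "q i < t + \<delta>" using q[of "t - \<delta>" "t + \<delta>"] \<delta>(1) by auto
    then have "d (U t) (U (q i)) < e / 2"
      using UH'[of t "q i"] \<delta>(2)[of "q i"] by (simp add: abs_less_iff)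
    moreover have "\<psi> i s - \<psi> i t \<le> N t - N s"
    proof (rule has_integral_le)
      have "(k i has_integral (\<psi> i t - \<psi> i s)) {s..t}" by (rule k[OF st])
      then have "((\<lambda>x. - k i x) has_integral (\<psi> i s - \<psi> i t)) {s..t}"
        by (drule_tac has_integral_neg) simp
      then show "((\<lambda>x. if x \<in> Z then 0 else - k i x) has_integral (\<psi> i s - \<psi> i t)) {s..t}"
        by (rule has_integral_spike[OF Zneg, rotated]) auto
      show "(n has_integral (N t - N s)) {s..t}" by (rule N[OF st])
      show "(if x \<in> Z then 0 else - k i x) \<le> n x" for x
        using kn[of x i] n0[of x] by (auto simp: abs_le_iff)
    qed
    moreover have "d (U s) (U t) \<le> d (U s) (U (q i)) + d (U t) (U (q i))"
      using triangle'[of "U s" "U (q i)" "U t"] by simp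
    ultimately show "d (U s) (U t) \<le> N t - N s + e" by (simp add: \<psi>_def)
  qed
  have UN': "d (U s) (U t) \<le> \<bar>N t - N s\<bar>" for s t
    using UN[of s t] UN[of t s] commute[of "U s" "U t"] by (cases "s \<le> t") auto
  \<comment> \<open>From below the limit is enforced by the members of the supremum, from above by
    \<open>UN'\<close>, because \<open>N\<close> has derivative \<open>n x\<close> at
    \<open>x\<close>.\<close>
  have lim: "((\<lambda>y. d (U x) (U y) / \<bar>x - y\<bar>) \<longlongrightarrow> n x) (at x)" if x: "x \<notin> Z" for x
  proof (rule order_tendstoI)
    fix a assume "a < n x"
    then obtain i where "a < min \<bar>k i x\<bar> (m0 x)"
      unfolding n_def using less_cSUP_iff[OF _ bdd] by auto
    then have "\<forall>\<^sub>F y in at x. a < \<bar>\<psi> i y - \<psi> i x\<bar> / \<bar>y - x\<bar>"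
      by (intro eventually_at_exceeds[OF \<psi>d[OF x]]) simp
    then show "\<forall>\<^sub>F y in at x. a < d (U x) (U y) / \<bar>x - y\<bar>"
    proof (rule eventually_mono)
      fix y assume "a < \<bar>\<psi> i y - \<psi> i x\<bar> / \<bar>y - x\<bar>"
      also have "\<dots> \<le> d (U x) (U y) / \<bar>y - x\<bar>" by (intro divide_right_mono \<psi>U) simp
      finally show "a < d (U x) (U y) / \<bar>x - y\<bar>" by (simp add: abs_minus_commute)
    qed
  next
    fix a assume "n x < a"
    then have "\<forall>\<^sub>F y in at x. \<bar>N y - N x\<bar> / \<bar>y - x\<bar> < a"
      using n0[of x] by (intro eventually_at_below[OF Nd[OF x]]) simp
    then show "\<forall>\<^sub>F y in at x. d (U x) (U y) / \<bar>x - y\<bar> < a"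
    proof (rule eventually_mono)
      fix y assume *: "\<bar>N y - N x\<bar> / \<bar>y - x\<bar> < a"
      have "d (U x) (U y) / \<bar>y - x\<bar> \<le> \<bar>N y - N x\<bar> / \<bar>y - x\<bar>" by (intro divide_right_mono UN') simp
      with * show "d (U x) (U y) / \<bar>x - y\<bar> < a" by (simp add: abs_minus_commute)
    qed
  qed
  have "metric_deriv {0..} d u x = n x" if x: "x \<notin> Z" "0 < x" for x
  proof -
    have "at x within {0..} = at x" using x(2) by (intro at_within_interior) auto
    moreover have "((\<lambda>y. d (u x) (u y) / \<bar>x - y\<bar>) \<longlongrightarrow> n x) (at x)"
    proof (rule Lim_transform_eventually[OF lim[OF x(1)]])
      have "\<forall>\<^sub>F y in at x. 0 < y" using x(2) by (intro order_tendstoD[OF tendsto_ident_at])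
      then show "\<forall>\<^sub>F y in at x. d (U x) (U y) / \<bar>x - y\<bar> = d (u x) (u y) / \<bar>x - y\<bar>"
        by eventually_elim (use x(2) in \<open>simp add: U_def max_def\<close>)
    qed
    ultimately show ?thesis unfolding metric_deriv_def by (intro tendsto_Lim) auto
  qed
  then have "AE t in lebesgue. 0 < t \<longrightarrow> metric_deriv {0..} d u t = n t"
    by (intro AE_lebesgueI_negligible[OF Zneg]) auto
  moreover have "d (u s) (u t) \<le> integral {s..t} n" if "0 \<le> s" "s \<le> t" for s t
    using UN[OF that(2)] that integral_unique[OF N[OF that(2)]] by (simp add: U_def)
  ultimately show thesis using that n_meas n0 nneg n_int np_int by blast
qed

section \<open>Energy estimates\<close>

text \<open>The best choice is \<open>c = x / \<tau>\<close>: then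
  \<open>c powr p * \<tau> = c powr (p - 1) * x\<close>, the multiples by \<open>p - 1\<close>
  cancel, and multiplication by \<open>\<tau> powr (p - 1)\<close> gives the claim. For
  \<open>\<tau> = 0\<close>, letting \<open>c\<close> grow forces \<open>x = 0\<close>.\<close>

lemma Young_imp_Holder:
  fixes p x \<tau> y :: real
  assumes p: "1 < p" and x: "0 \<le> x" and \<tau>: "0 \<le> \<tau>" and y: "0 \<le> y"
    and le: "\<And>c. 0 < c \<Longrightarrow> p * c powr (p - 1) * x \<le> (p - 1) * c powr p * \<tau> + y"
  shows "x powr p \<le> \<tau> powr (p - 1) * y"
proof (cases "\<tau> = 0 \<or> x = 0")
  case True
  have "x = 0" if "\<tau> = 0"
    by (rule le_all_powr_imp_0[of p "p - 1" _ y]) (use le that p x y in auto)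
  with True show ?thesis using y by auto
next
  case False
  then have pos: "0 < x" "0 < \<tau>" using x \<tau> by auto
  define c where "c = x / \<tau>"
  have c: "0 < c" using pos by (simp add: c_def)
  have "c powr p * \<tau> = c powr (p - 1) * x"
    using powr_add[of c "p - 1" 1] c pos by (simp add: c_def)
  then have "(p - 1) * c powr p * \<tau> = (p - 1) * (c powr (p - 1) * x)" by (simp add: mult.assoc)
  then have "c powr (p - 1) * x \<le> y"
    using le[OF c] by (simp add: algebra_simps)
  then have "\<tau> powr (p - 1) * (c powr (p - 1) * x) \<le> \<tau> powr (p - 1) * y"
    by (intro mult_left_mono) auto
  moreover have "\<tau> powr (p - 1) * (c powr (p - 1) * x) = x powr (p - 1) * x"
    using pos by (simp add: c_def powr_divide)
  moreover have "x powr (p - 1) * x = x powr p"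
    using powr_add[of x "p - 1" 1] pos by simp
  ultimately show ?thesis by simp
qed

text \<open>
  On time steps so short that \<open>(t - s)\<^sup>p\<^sup>-\<^sup>1 K2 \<le> 4\<^sup>-\<^sup>p\<close> the hypothesis gives
  \<open>\<Delta> s t \<le> (2 K1)\<^sup>1\<^sup>/\<^sup>p + D t / 2\<close>, hence \<open>D t \<le> 2 D s + const\<close>; iterate.
\<close>

lemma superlinear_growth_bound:
  fixes p K1 K2 R T :: real
  assumes p: "1 < p" and K: "0 \<le> K1" "0 \<le> K2"
  obtains B where "\<And>D \<Delta> t. \<lbrakk>D 0 \<le> R; \<And>t. 0 \<le> t \<Longrightarrow> 0 \<le> D t;
      \<And>s t. \<lbrakk>0 \<le> s; s \<le> t\<rbrakk> \<Longrightarrow> D t \<le> D s + \<Delta> s t \<and> 0 \<le> \<Delta> s t \<and>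
        \<Delta> s t powr p \<le> (t - s) powr (p - 1) * (K1 + K2 * D t powr p);
      0 \<le> t; t \<le> T\<rbrakk> \<Longrightarrow> D t \<le> (B :: real)"
proof -
  \<comment> \<open>A threshold for \<open>\<tau> powr (p - 1)\<close>: up to it, the product with
    \<open>K2\<close> is at most \<open>1 / 4 powr p\<close>. The summand 1 avoids division by zero
    when \<open>K2 = 0\<close>.\<close>
  define Q where "Q = 1 / (4 powr p * (K2 + 1))"
  have Q: "0 < Q"
    unfolding Q_def
  proof (rule divide_pos_pos)
    show "0 < 4 powr p * (K2 + 1)" using K by (intro mult_pos_pos) auto
  qed simp
  \<comment> \<open>The cap 1 keeps the factor in front of \<open>K1\<close> at most 1.\<close>
  define \<tau> where "\<tau> = min 1 (Q powr (1 / (p - 1)))"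
  have \<tau>: "0 < \<tau>" using Q by (simp add: \<tau>_def)
  have \<tau>1: "\<tau> powr (p - 1) \<le> 1"
    using \<tau> p powr_mono2[of "p - 1" \<tau> 1] by (simp add: \<tau>_def)
  have "\<tau> powr (p - 1) \<le> (Q powr (1 / (p - 1))) powr (p - 1)"
    using \<tau> p by (intro powr_mono2) (auto simp: \<tau>_def)
  also have "\<dots> = Q"
    unfolding powr_powr using p Q by simp
  finally have "\<tau> powr (p - 1) * K2 \<le> Q * K2"
    using K by (intro mult_right_mono)
  also have "\<dots> \<le> Q * (K2 + 1)" using Q by (intro mult_left_mono) auto
  also have "\<dots> = 1 / 4 powr p" using K by (simp add: Q_def)
  finally have \<tau>2: "\<tau> powr (p - 1) * K2 \<le> 1 / 4 powr p" .
  define K3 where "K3 = (2 * K1) powr (1 / p)"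
  \<comment> \<open>The recursion belonging to \<open>D t \<le> 2 * D s + 2 * K3\<close>. It
    involves neither \<open>D\<close> nor \<open>\<Delta>\<close>, so the bound \<open>b n\<close>
    is the same for all curves.\<close>
  define b where "b = rec_nat R (\<lambda>_ x. 2 * x + 2 * K3)"
  have b: "b 0 = R" "b (Suc n) = 2 * b n + 2 * K3" for n by (simp_all add: b_def)
  obtain n where n: "T < real n * \<tau>" using reals_Archimedean3[OF \<tau>] by blast
  show thesis
  proof (rule that)
    fix D :: "real \<Rightarrow> real" and \<Delta> t
    assume D0: "D 0 \<le> R" and D: "\<And>t. 0 \<le> t \<Longrightarrow> 0 \<le> D t"
      and step: "\<And>s t. \<lbrakk>0 \<le> s; s \<le> t\<rbrakk> \<Longrightarrow> D t \<le> D s + \<Delta> s t \<and> 0 \<le> \<Delta> s t \<and>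
        \<Delta> s t powr p \<le> (t - s) powr (p - 1) * (K1 + K2 * D t powr p)"
      and t: "0 \<le> t" "t \<le> T"
    have step': "D t \<le> 2 * D s + 2 * K3" if st: "0 \<le> s" "s \<le> t" "t - s \<le> \<tau>" for s t
    proof -
      have Dt: "0 \<le> D t" using st D by simp
      have "\<Delta> s t powr p \<le> (t - s) powr (p - 1) * (K1 + K2 * D t powr p)"
        using step[OF st(1,2)] by blast
      also have "\<dots> \<le> \<tau> powr (p - 1) * (K1 + K2 * D t powr p)"
        using st K p by (intro mult_right_mono powr_mono2 add_nonneg_nonneg mult_nonneg_nonneg) auto
      also have "\<dots> = \<tau> powr (p - 1) * K1 + (\<tau> powr (p - 1) * K2) * D t powr p"
        by (simp add: algebra_simps)
      also have "\<dots> \<le> 1 * K1 + 1 / 4 powr p * D t powr p"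
        using K by (intro add_mono mult_right_mono \<tau>1 \<tau>2) auto
      also have "\<dots> = K1 + (D t / 4) powr p" using Dt by (simp add: powr_divide)
      finally have le: "\<Delta> s t powr p \<le> K1 + (D t / 4) powr p" .
      \<comment> \<open>Otherwise \<open>\<Delta> s t powr p\<close> is at least
        \<open>2 * K1\<close> and exceeds \<open>2 * (D t / 4) powr p\<close>, hence it exceeds the
        sum in \<open>le\<close>. The quarter, rather than a half, absorbs this factor 2 by
        \<open>2 \<le> 2 powr p\<close>.\<close>
      have "\<Delta> s t \<le> K3 + D t / 2"
      proof (rule ccontr)
        assume neg: "\<not> ?thesis"
        have K3: "0 \<le> K3" by (simp add: K3_def)
        have "2 * K1 = K3 powr p" using K p by (simp add: K3_def powr_powr)
        also have "\<dots> \<le> \<Delta> s t powr p" using neg K3 Dt p by (intro powr_mono2) auto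
        finally have 1: "2 * K1 \<le> \<Delta> s t powr p" .
        have "2 * (D t / 4) powr p \<le> 2 powr p * (D t / 4) powr p"
          using p powr_mono[of 1 p 2] by (intro mult_right_mono) auto
        also have "\<dots> = (D t / 2) powr p"
          using Dt powr_mult[of 2 "D t / 4" p] by simp
        also have "\<dots> < \<Delta> s t powr p" using neg K3 Dt p by (intro powr_less_mono2) auto
        finally show False using 1 le by simp
      qed
      moreover have "D t \<le> D s + \<Delta> s t" using step[OF st(1,2)] by blast
      ultimately show ?thesis by simp
    qed
    have "D t \<le> b m" if "0 \<le> t" "t \<le> real m * \<tau>" for m t
      using that
    proof (induction m arbitrary: t)
      case 0
      then show ?case using D0 b by simp
    next
      case (Suc m)
      have "D (max 0 (t - \<tau>)) \<le> b m"
        using Suc.prems \<tau> by (intro Suc.IH) (auto simp: algebra_simps)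
      moreover have "D t \<le> 2 * D (max 0 (t - \<tau>)) + 2 * K3"
        using Suc.prems \<tau> by (intro step') auto
      ultimately show ?case by (simp add: b)
    qed
    then show "D t \<le> b n" using t n by simp
  qed
qed

text \<open>Passes from the identity between extended reals to real quantities: \<open>n\<close> is
  a density that equals the metric derivative almost everywhere on \<open>[0,\<infinity>)\<close>,
  and \<open>P\<close> is the energy along the curve, finite because it starts finite and cannot
  increase. The gradient integral is nonnegative, so the identity bounds the integral of
  \<open>n powr \<theta>\<close> by \<theta> times the energy loss.\<close>

lemma max_slope_curve_energy:
  assumes M: "Metric_space M d" and \<theta>: "1 < \<theta>" and \<beta>: "1 / \<theta> + 1 / \<beta> = 1"
    and u: "max_slope_curve \<theta> \<beta> M d \<phi> g w u" and \<phi>: "\<And>x. x \<in> M \<Longrightarrow> -\<infinity> < \<phi> x"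
  obtains n P where "\<And>x. 0 \<le> n x" "\<And>x. x < 0 \<Longrightarrow> n x = 0"
    "\<And>a b. n integrable_on {a..b}" "\<And>a b. (\<lambda>x. n x powr \<theta>) integrable_on {a..b}"
    "\<And>s t. 0 \<le> s \<Longrightarrow> s \<le> t \<Longrightarrow> d (u s) (u t) \<le> integral {s..t} n"
    "\<And>t. 0 \<le> t \<Longrightarrow> \<phi> (u t) = ereal (P t)"
    "\<And>s t. 0 \<le> s \<Longrightarrow> s \<le> t \<Longrightarrow> integral {s..t} (\<lambda>x. n x powr \<theta>) \<le> \<theta> * (P s - P t)"
proof -
  have \<beta>0: "0 < \<beta>"
  proof -
    have "1 / \<theta> < 1" using \<theta> by simp
    then have "0 < 1 / \<beta>" using \<beta> by linarith
    then show ?thesis by simp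
  qed
  from u have w: "w \<in> M" "\<phi> w < \<infinity>" and AC: "AC_loc_curve \<theta> {0..} M d u" and u0: "u 0 = w"
    and energy: "\<And>s t. 0 \<le> s \<Longrightarrow> s < t \<Longrightarrow> \<phi> (u t) - \<phi> (u s) =
          - (ereal (1 / \<beta>) * enn2ereal (\<integral>\<^sup>+ r\<in>{s..t}. ennreal_powr (g (u r)) \<beta> \<partial>lebesgue))
          - ereal (1 / \<theta>) *
              enn2ereal (\<integral>\<^sup>+ r\<in>{s..t}. ennreal (metric_deriv {0..} d u r powr \<theta>) \<partial>lebesgue)"
    by (auto simp: max_slope_curve_def eff_dom_def)
  obtain n where n: "\<And>x. 0 \<le> n x" "\<And>x. x < 0 \<Longrightarrow> n x = 0"
    "\<And>a b. n integrable_on {a..b}" "\<And>a b. (\<lambda>x. n x powr \<theta>) integrable_on {a..b}"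
    "\<And>s t. 0 \<le> s \<Longrightarrow> s \<le> t \<Longrightarrow> d (u s) (u t) \<le> integral {s..t} n"
    "AE t in lebesgue. 0 < t \<longrightarrow> metric_deriv {0..} d u t = n t"
    by (rule metric_deriv_density[OF M \<theta> AC]) (rule that; assumption)
  have deriv: "(\<integral>\<^sup>+ r\<in>{s..t}. ennreal (metric_deriv {0..} d u r powr \<theta>) \<partial>lebesgue)
      = ennreal (integral {s..t} (\<lambda>x. n x powr \<theta>))" if "0 \<le> s" for s t
  proof -
    \<comment> \<open>The metric derivative is identified at positive times, so the endpoint 0 has
      to be removed as well.\<close>
    have "AE r in lebesgue. r \<noteq> (0::real)"
      by (rule AE_lebesgueI_negligible[OF negligible_sing[of 0]]) simp
    with n(6) have "(\<integral>\<^sup>+ r\<in>{s..t}. ennreal (metric_deriv {0..} d u r powr \<theta>) \<partial>lebesgue)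
        = (\<integral>\<^sup>+ r\<in>{s..t}. ennreal (n r powr \<theta>) \<partial>lebesgue)"
      by (intro nn_integral_cong_AE, eventually_elim) (use that in \<open>auto simp: indicator_def\<close>)
    also have "\<dots> = ennreal (integral {s..t} (\<lambda>x. n x powr \<theta>))"
      unfolding nn_integral_completion
      using n(4)[of s t] by (intro nn_integral_has_integral_lebesgue') (auto simp: has_integral_integrable_integral)
    finally show ?thesis .
  qed
  have diss: "\<phi> (u t) - \<phi> (u s) \<le> - ereal (1 / \<theta> * integral {s..t} (\<lambda>x. n x powr \<theta>))"
    if st: "0 \<le> s" "s < t" for s t
  proof -
    let ?I = "enn2ereal (\<integral>\<^sup>+ r\<in>{s..t}. ennreal_powr (g (u r)) \<beta> \<partial>lebesgue)"
    have int0: "0 \<le> integral {s..t} (\<lambda>x. n x powr \<theta>)"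
      by (intro integral_nonneg n(4)) simp
    have "0 \<le> ereal (1 / \<beta>) * ?I" using \<beta>0 by (intro ereal_0_le_mult) auto
    then have "- (ereal (1 / \<beta>) * ?I) \<le> 0" by simp
    then have "- (ereal (1 / \<beta>) * ?I) - ereal (1 / \<theta> * integral {s..t} (\<lambda>x. n x powr \<theta>))
        \<le> 0 - ereal (1 / \<theta> * integral {s..t} (\<lambda>x. n x powr \<theta>))"
      by (intro ereal_minus_mono) auto
    then show ?thesis
      unfolding energy[OF st] deriv[OF st(1)] using int0 by (simp add: enn2ereal_ennreal)
  qed
  have uM: "u t \<in> M" if "0 \<le> t" for t using AC that by (auto simp: AC_loc_curve_def)
  obtain P0 where P0: "\<phi> w = ereal P0" using w \<phi>[OF w(1)] by (cases "\<phi> w") auto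
  have fin: "\<bar>\<phi> (u t)\<bar> \<noteq> \<infinity>" if t: "0 \<le> t" for t
  proof (cases "t = 0")
    case True
    then show ?thesis using P0 u0 by simp
  next
    case False
    then have "\<phi> (u t) - ereal P0 \<le> - ereal (1 / \<theta> * integral {0..t} (\<lambda>x. n x powr \<theta>))"
      using diss[of 0 t] t u0 P0 by simp
    then show ?thesis using \<phi>[OF uM[OF t]] by (cases "\<phi> (u t)") auto
  qed
  define P where "P = (\<lambda>t. real_of_ereal (\<phi> (u t)))"
  have P: "\<phi> (u t) = ereal (P t)" if "0 \<le> t" for t
    using fin[OF that] by (simp add: P_def ereal_real)
  have "integral {s..t} (\<lambda>x. n x powr \<theta>) \<le> \<theta> * (P s - P t)" if "0 \<le> s" "s \<le> t" for s t
  proof (cases "s = t")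
    case False
    then have "P t - P s \<le> - (1 / \<theta> * integral {s..t} (\<lambda>x. n x powr \<theta>))"
      using diss[of s t] that by (simp add: P)
    then show ?thesis using \<theta> by (simp add: field_simps)
  qed simp
  from that[OF n(1-5) P this] show thesis .
qed

section \<open>Compactness\<close>

text \<open>The second half of Helly's selection: limits are at hand at rational points only, and
  their right limits form a right-continuous monotone function on the line. By monotonicity the
  infimum is the right limit, whichever rational sequence is used.\<close>

lemma right_regularization:
  fixes f F :: "real \<Rightarrow> real"
  assumes mono: "\<And>q q'. q \<in> \<rat> \<Longrightarrow> q' \<in> \<rat> \<Longrightarrow> q \<le> q' \<Longrightarrow> f q \<le> f q'"
  defines "F \<equiv> \<lambda>t. INF q\<in>{q \<in> \<rat>. t < q}. f q"
  shows "right_cont_mono F"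
    and "\<lbrakk>range X \<subseteq> \<rat>; \<And>n. t < X n; X \<longlonglongrightarrow> t\<rbrakk> \<Longrightarrow> (\<lambda>n. f (X n)) \<longlonglongrightarrow> F t"
proof -
  have bdd: "bdd_below (f ` {q \<in> \<rat>. t < q})" for t
  proof -
    obtain r where "r \<in> \<rat>" "r < t" using Rats_dense_in_real[of "t - 1" t] by auto
    then show ?thesis by (intro bdd_belowI[of _ "f r"]) (auto intro!: mono)
  qed
  have ne: "{q \<in> \<rat>. t < q} \<noteq> {}" for t :: real
    using Rats_dense_in_real[of t "t + 1"] by auto
  have lower: "F t \<le> f q" if "q \<in> \<rat>" "t < q" for t q
    unfolding F_def using that by (intro cINF_lower bdd) auto
  have approx: "\<exists>q\<in>\<rat>. t < q \<and> f q < F t + e" if "0 < e" for t e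
    using cINF_less_iff[OF ne bdd, of t "F t + e"] that unfolding F_def by auto
  have F: "F s \<le> F t" if "s \<le> t" for s t
  proof (rule field_le_epsilon)
    fix e :: real assume "0 < e"
    from approx[OF this, of t] obtain q where "q \<in> \<rat>" "t < q" "f q < F t + e" by blast
    then show "F s \<le> F t + e" using lower[of q s] that by simp
  qed
  have "continuous (at_right t) F" for t
    unfolding continuous_within
  proof (rule tendstoI)
    fix e :: real assume "0 < e"
    from approx[OF this, of t] obtain q where q: "q \<in> \<rat>" "t < q" "f q < F t + e" by blast
    show "\<forall>\<^sub>F y in at_right t. dist (F y) (F t) < e"
      unfolding eventually_at_right_field
    proof (intro exI[of _ q] conjI allI impI)
      fix y assume y: "t < y" "y < q"
      then show "dist (F y) (F t) < e" using lower[OF q(1) y(2)] F[of t y] q(3) by (simp add: dist_real_def)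
    qed (use q in simp)
  qed
  then show "right_cont_mono F" using F by (simp add: right_cont_mono_def mono_def)
  show "(\<lambda>n. f (X n)) \<longlonglongrightarrow> F t" if X: "range X \<subseteq> \<rat>" "\<And>n. t < X n" "X \<longlonglongrightarrow> t"
  proof (rule tendstoI)
    fix e :: real assume "0 < e"
    from approx[OF this, of t] obtain q where q: "q \<in> \<rat>" "t < q" "f q < F t + e" by blast
    have "\<forall>\<^sub>F n in sequentially. X n < q" using X(3) q(2) by (rule order_tendstoD)
    then show "\<forall>\<^sub>F n in sequentially. dist (f (X n)) (F t) < e"
    proof eventually_elim
      case (elim n)
      have "X n \<in> \<rat>" using X(1) by auto
      with elim have "f (X n) \<le> f q" "F t \<le> f (X n)" using q X(2) by (auto intro: mono lower)
      then show ?case using q(3) by (simp add: dist_real_def)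
    qed
  qed
qed

lemma rational_sequence_above:
  fixes t :: real
  obtains X where "range X \<subseteq> \<rat>" "\<And>n. t < X n" "X \<longlonglongrightarrow> t"
proof -
  have "\<exists>q\<in>\<rat>. t < q \<and> q < t + 1 / real (Suc n)" for n by (rule Rats_dense_in_real) simp
  then obtain X where X: "\<And>n. X n \<in> \<rat>" "\<And>n. t < X n" "\<And>n. X n < t + 1 / real (Suc n)" by metis
  have "X \<longlonglongrightarrow> t"
  proof (rule tendsto_sandwich[of "\<lambda>_. t" X _ "\<lambda>n. t + 1 / real (Suc n)"])
    show "(\<lambda>n. t + 1 / real (Suc n)) \<longlonglongrightarrow> t"
      using tendsto_add[OF tendsto_const[of t] lim_inverse_n'[THEN LIMSEQ_Suc]] by simp
    show "(\<lambda>n. t) \<longlonglongrightarrow> t" by simp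
  qed (use X in \<open>auto intro!: always_eventually less_imp_le\<close>)
  with X that show thesis by blast
qed

lemma bounded_real_subseq_convergent:
  fixes x :: "nat \<Rightarrow> real"
  assumes "\<And>k. \<bar>x k\<bar> \<le> A"
  obtains r where "strict_mono r" "convergent (x \<circ> r)"
proof -
  have "bounded (range x)" using assms by (auto simp: bounded_iff)
  then obtain l r where "strict_mono (r :: nat \<Rightarrow> nat)" "(x \<circ> r) \<longlonglongrightarrow> l"
    by (metis bounded_imp_convergent_subsequence)
  then show thesis using that by (auto simp: convergent_def)
qed

text \<open>The Urysohn subsequence principle, valid in any topological space: a failure would put
  infinitely many terms outside one open neighbourhood of \<open>l\<close>, and no subsequence of
  these can converge to \<open>l\<close>.\<close>

lemma limitin_by_subsequences:
  assumes "l \<in> topspace X"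
    and sub: "\<And>r. strict_mono (r :: nat \<Rightarrow> nat) \<Longrightarrow> \<exists>r'. strict_mono r' \<and> limitin X (x \<circ> r \<circ> r') l sequentially"
  shows "limitin X x l sequentially"
  unfolding limitin_def
proof (intro conjI allI impI)
  fix U assume U: "openin X U \<and> l \<in> U"
  show "\<forall>\<^sub>F k in sequentially. x k \<in> U"
  proof (rule ccontr)
    assume "\<not> ?thesis"
    then have "infinite {k. x k \<notin> U}"
      by (simp add: not_eventually cofinite_eq_sequentially[symmetric] frequently_cofinite)
    then obtain r where r: "strict_mono (r :: nat \<Rightarrow> nat)" "\<And>k. x (r k) \<notin> U"
      using infinite_enumerate by blast
    obtain r' where "limitin X (x \<circ> r \<circ> r') l sequentially" using sub[OF r(1)] by blast
    then have "\<forall>\<^sub>F k in sequentially. (x \<circ> r \<circ> r') k \<in> U" using U by (simp add: limitin_def)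
    then show False using r(2) by (simp add: eventually_sequentially)
  qed
qed (fact assms(1))

text \<open>An Arzela-Ascoli argument for \<sigma>, joined with Helly selection for \<open>F\<close>
  and \<open>G\<close>, which stand for the primitives of a bound for the speed and of its power
  \<open>p\<close>. Bounds on \<open>G\<close> give equicontinuity, and the Young inequalities that
  remain in the limit give the density of the limit curve.\<close>

lemma AC_limit_curve:
  fixes u :: "nat \<Rightarrow> real \<Rightarrow> 'a" and F G :: "nat \<Rightarrow> real \<Rightarrow> real"
  assumes M: "Metric_space S d" and \<sigma>: "topspace \<sigma> = S" and p: "1 < p"
    and lsc: "\<And>x y a b. \<lbrakk>range x \<subseteq> S; range y \<subseteq> S;
        limitin \<sigma> x a sequentially; limitin \<sigma> y b sequentially\<rbrakk>
        \<Longrightarrow> ereal (d a b) \<le> liminf (\<lambda>k. ereal (d (x k) (y k)))"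
    and uS: "\<And>k t. 0 \<le> t \<Longrightarrow> u k t \<in> S"
    and F: "\<And>k s t. s \<le> t \<Longrightarrow> F k s \<le> F k t" "\<And>k t. t \<le> 0 \<Longrightarrow> F k t = 0"
    and G: "\<And>k s t. s \<le> t \<Longrightarrow> G k s \<le> G k t" "\<And>k t. t \<le> 0 \<Longrightarrow> G k t = 0"
    and uF: "\<And>k s t. 0 \<le> s \<Longrightarrow> s \<le> t \<Longrightarrow> d (u k s) (u k t) \<le> F k t - F k s"
    and Young: "\<And>k c s t. 0 < c \<Longrightarrow> s \<le> t \<Longrightarrow>
        p * c powr (p - 1) * (F k t - F k s) \<le> (p - 1) * c powr p * (t - s) + (G k t - G k s)"
    and bound: "\<And>T. \<exists>A. \<forall>k. G k T \<le> A"
    and compact: "\<And>t (s :: nat \<Rightarrow> nat). 0 \<le> t \<Longrightarrow> strict_mono s \<Longrightarrow>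
        \<exists>(r :: nat \<Rightarrow> nat) a. strict_mono r \<and> a \<in> S \<and> limitin \<sigma> (\<lambda>k. u (s (r k)) t) a sequentially"
  obtains r v where "strict_mono r" "AC_loc_curve p {0..} S d v"
    "\<And>t. 0 \<le> t \<Longrightarrow> limitin \<sigma> (\<lambda>k. u (r k) t) (v t) sequentially"
proof -
  interpret Metric_space S d by (rule M)
  have lsc_le: "d a b \<le> l"
    if "range x \<subseteq> S" "range y \<subseteq> S" "limitin \<sigma> x a sequentially" "limitin \<sigma> y b sequentially"
      "\<And>k :: nat. d (x k) (y k) \<le> z k" "z \<longlonglongrightarrow> l" for x y a b z l
  proof -
    have "ereal (d a b) \<le> liminf (\<lambda>k. ereal (d (x k) (y k)))" by (rule lsc) (fact that)+
    also have "\<dots> \<le> liminf (\<lambda>k. ereal (z k))"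
      by (intro Liminf_mono always_eventually allI) (simp add: that)
    also have "\<dots> = ereal l" using that(6) by (intro lim_imp_Liminf) auto
    finally show ?thesis by simp
  qed
  obtain A where A: "\<And>k T. G k T \<le> A T" using bound by metis
  have G0: "0 \<le> G k t" for k t using G(1)[of "min 0 t" t k] G(2)[of "min 0 t" k] by simp
  have F0: "0 \<le> F k t" for k t using F(1)[of "min 0 t" t k] F(2)[of "min 0 t" k] by simp
  \<comment> \<open>Young's inequality with \<open>c = 1\<close> between 0 and \<open>T\<close>
    bounds \<open>F\<close> in terms of \<open>G\<close>.\<close>
  have FA: "\<bar>F k T\<bar> \<le> \<bar>((p - 1) * T + A T) / p\<bar>" for k T
  proof (cases "T \<le> 0")
    case False
    then have "p * F k T \<le> (p - 1) * T + A T"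
      using Young[of 1 0 T k] F(2)[of 0 k] G(2)[of 0 k] A[of k T] by simp
    then have "F k T \<le> ((p - 1) * T + A T) / p" using p by (simp add: field_simps)
    then show ?thesis unfolding abs_of_nonneg[OF F0] by (rule order_trans[OF _ abs_ge_self])
  qed (simp add: F)
  have GA: "\<bar>G k T\<bar> \<le> \<bar>A T\<bar>" for k T using A[of k T] G0[of k T] by simp
  \<comment> \<open>The modulus of continuity on \<open>[0,T]\<close> from Hoelder's inequality,
    common to all \<open>k\<close>.\<close>
  define \<omega> where "\<omega> = (\<lambda>T x. (x powr (p - 1) * A T) powr (1 / p))"
  have A0: "0 \<le> A T" for T using A[of 0 T] G0[of 0 T] by simp
  have Holder: "d (u k s) (u k t) \<le> \<omega> T (t - s)" if st: "0 \<le> s" "s \<le> t" "t \<le> T" for k s t T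
  proof -
    have "p * c powr (p - 1) * d (u k s) (u k t) \<le> (p - 1) * c powr p * (t - s) + A T" if c: "0 < c" for c
    proof -
      have "p * c powr (p - 1) * d (u k s) (u k t) \<le> p * c powr (p - 1) * (F k t - F k s)"
        using p uF[OF st(1,2), of k] by (intro mult_left_mono) auto
      also have "\<dots> \<le> (p - 1) * c powr p * (t - s) + (G k t - G k s)" by (rule Young[OF c st(2)])
      also have "\<dots> \<le> (p - 1) * c powr p * (t - s) + A T"
        using G(1)[OF st(3), of k] A[of k T] G0[of k s] by simp
      finally show ?thesis .
    qed
    then have "d (u k s) (u k t) powr p \<le> (t - s) powr (p - 1) * A T"
      by (intro Young_imp_Holder[OF p]) (use st A0 in auto)
    then have "(d (u k s) (u k t) powr p) powr (1 / p) \<le> \<omega> T (t - s)"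
      unfolding \<omega>_def using p by (intro powr_mono2) auto
    then show ?thesis using p by (simp add: powr_powr)
  qed
  have \<omega>_lim: "(\<lambda>n. \<omega> T (x n)) \<longlonglongrightarrow> 0" if "x \<longlonglongrightarrow> 0" "\<And>n. 0 \<le> x n" for T and x :: "nat \<Rightarrow> real"
  proof -
    have "(\<lambda>n. x n powr (p - 1)) \<longlonglongrightarrow> 0 powr (p - 1)"
      using that p by (intro tendsto_powr2) (auto intro!: always_eventually)
    then have "(\<lambda>n. x n powr (p - 1) * A T) \<longlonglongrightarrow> 0 * A T"
      by (intro tendsto_mult) auto
    then have "(\<lambda>n. (x n powr (p - 1) * A T) powr (1 / p)) \<longlonglongrightarrow> 0 powr (1 / p)"
      using p A0 by (intro tendsto_powr2) (auto intro!: always_eventually)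
    then show ?thesis by (simp add: \<omega>_def)
  qed
  define q where "q = (\<lambda>i. from_nat_into (\<rat> :: real set) i)"
  have q: "\<exists>i. x = q i" if "x \<in> \<rat>" for x
    using from_nat_into_surj[OF countable_rat that] by (auto simp: q_def)
  \<comment> \<open>What is required of a subsequence at the \<open>i\<close>-th rational. At
    negative rationals there is no curve, but \<open>F\<close> and \<open>G\<close> are still
    considered, since they are regularized on the whole line.\<close>
  let ?P = "\<lambda>i s. convergent (\<lambda>k. F (s k) (q i)) \<and> convergent (\<lambda>k. G (s k) (q i))
    \<and> (0 \<le> q i \<longrightarrow> (\<exists>a. limitin \<sigma> (\<lambda>k. u (s k) (q i)) a sequentially))"
  interpret subseqs ?P
  proof
    fix i and s :: "nat \<Rightarrow> nat" assume s: "strict_mono s"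
    obtain r1 where r1: "strict_mono r1" "convergent ((\<lambda>k. F (s k) (q i)) \<circ> r1)"
      using bounded_real_subseq_convergent[of "\<lambda>k. F (s k) (q i)", OF FA] by blast
    obtain r2 where r2: "strict_mono r2" "convergent ((\<lambda>k. G (s (r1 k)) (q i)) \<circ> r2)"
      using bounded_real_subseq_convergent[of "\<lambda>k. G (s (r1 k)) (q i)", OF GA] by blast
    have s12: "strict_mono (s \<circ> r1 \<circ> r2)" by (intro strict_mono_o s r1 r2)
    obtain r3 where r3: "strict_mono r3"
      "0 \<le> q i \<longrightarrow> (\<exists>a. limitin \<sigma> (\<lambda>k. u ((s \<circ> r1 \<circ> r2) (r3 k)) (q i)) a sequentially)"
    proof (cases "0 \<le> q i")
      case True
      from compact[OF this s12] show ?thesis using that by blast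
    next
      case False
      then show ?thesis using that[of id] by (auto simp: strict_mono_def)
    qed
    have "convergent ((\<lambda>k. F (s k) (q i)) \<circ> r1 \<circ> (r2 \<circ> r3))"
      by (rule convergent_subseq_convergent[OF r1(2) strict_mono_o[OF r2(1) r3(1)]])
    moreover have "convergent ((\<lambda>k. G (s (r1 k)) (q i)) \<circ> r2 \<circ> r3)"
      by (rule convergent_subseq_convergent[OF r2(2) r3(1)])
    ultimately have "?P i (s \<circ> (r1 \<circ> r2 \<circ> r3))" using r3 by (simp add: o_def)
    then show "\<exists>r'. strict_mono r' \<and> ?P i (s \<circ> r')"
      using r1 r2 r3 by (intro exI[of _ "r1 \<circ> r2 \<circ> r3"]) (auto intro: strict_mono_o)
  qed
  define r where "r = diagseq"
  have r: "strict_mono r" unfolding r_def by (rule subseq_diagseq)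
  \<comment> \<open>The diagonal sequence is controlled at the \<open>i\<close>-th rational only
    from index \<open>Suc i\<close> on. Convergence ignores the discarded initial terms, which is
    how the shift is removed below.\<close>
  have P: "?P i (r \<circ> (+) (Suc i))" for i
    unfolding r_def
  proof (rule diagseq_holds)
    fix \<rho> s :: "nat \<Rightarrow> nat" and j
    assume \<rho>: "strict_mono \<rho>" and Pj: "?P j s"
    have "convergent ((\<lambda>k. F (s k) (q j)) \<circ> \<rho>)" "convergent ((\<lambda>k. G (s k) (q j)) \<circ> \<rho>)"
      using Pj \<rho> by (auto intro!: convergent_subseq_convergent)
    moreover have "\<exists>a. limitin \<sigma> ((\<lambda>k. u (s k) (q j)) \<circ> \<rho>) a sequentially" if "0 \<le> q j"
      using Pj \<rho> that by (blast intro: limitin_subsequence)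
    ultimately show "?P j (s \<circ> \<rho>)" by (simp add: o_def)
  qed
  have shift: "convergent x" if "convergent (\<lambda>k. x (Suc i + k))" for x :: "nat \<Rightarrow> real" and i
    using that convergent_ignore_initial_segment[of x "Suc i"] by (simp add: add.commute)
  have conv: "convergent (\<lambda>k. F (r k) x)" "convergent (\<lambda>k. G (r k) x)" if xQ: "x \<in> \<rat>" for x
  proof -
    obtain i where "x = q i" using q[OF xQ] by blast
    with P[of i] have *: "convergent (\<lambda>k. F (r (Suc i + k)) x)" "convergent (\<lambda>k. G (r (Suc i + k)) x)"
      by (simp_all only: o_def)
    show "convergent (\<lambda>k. F (r k) x)" "convergent (\<lambda>k. G (r k) x)"
      using shift[OF *(1)] shift[OF *(2)] by simp_all
  qed
  have "\<exists>a. limitin \<sigma> (\<lambda>k. u (r k) x) a sequentially" if x: "x \<in> \<rat>" "0 \<le> x" for x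
  proof -
    obtain i where i: "x = q i" using q[OF x(1)] by blast
    with P[of i] x(2) have "\<exists>a. limitin \<sigma> (\<lambda>k. u (r (k + Suc i)) x) a sequentially"
      by (simp only: o_def add.commute[of "Suc i"])
    then show ?thesis
      unfolding limitin_def eventually_sequentially_seg[of "\<lambda>k. u (r k) x \<in> _" "Suc i"] .
  qed
  then obtain vq where vq: "\<And>x. x \<in> \<rat> \<Longrightarrow> 0 \<le> x \<Longrightarrow> limitin \<sigma> (\<lambda>k. u (r k) x) (vq x) sequentially"
    by metis
  \<comment> \<open>By equicontinuity and lower semicontinuity, every subsequence limit at time
    \<open>t\<close> is close to the limit at a slightly later rational time
    \<open>x\<close>.\<close>
  have near: "d a (vq x) \<le> \<omega> (t + 1) (x - t)"
    if t: "0 \<le> t" "t < x" "x \<le> t + 1" "x \<in> \<rat>" and \<rho>: "strict_mono \<rho>"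
      and a: "limitin \<sigma> (\<lambda>k. u (r (\<rho> k)) t) a sequentially" for t x \<rho> a
  proof (rule lsc_le[OF _ _ a])
    show "limitin \<sigma> (\<lambda>k. u (r (\<rho> k)) x) (vq x) sequentially"
      using limitin_subsequence[OF \<rho> vq[of x]] t by (simp add: o_def)
    show "d (u (r (\<rho> k)) t) (u (r (\<rho> k)) x) \<le> \<omega> (t + 1) (x - t)" for k
      using t by (intro Holder) auto
  qed (use t uS in auto)
  have "\<exists>a. limitin \<sigma> (\<lambda>k. u (r k) t) a sequentially" if t: "0 \<le> t" for t
  proof -
    obtain X where X: "range X \<subseteq> \<rat>" "\<And>n. t < X n" "X \<longlonglongrightarrow> t" using rational_sequence_above[of t] by blast
    have ev: "\<forall>\<^sub>F n in sequentially. X n \<le> t + 1"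
      using order_tendstoD(2)[OF X(3), of "t + 1"] by (auto elim: eventually_mono)
    have \<omega>0: "(\<lambda>n. 2 * \<omega> (t + 1) (X n - t)) \<longlonglongrightarrow> 0"
      using X by (intro tendsto_mult_right_zero \<omega>_lim) (auto simp: less_imp_le LIM_zero)
    obtain r1 a where a: "strict_mono r1" "a \<in> S" "limitin \<sigma> (\<lambda>k. u (r (r1 k)) t) a sequentially"
      using compact[OF t r] by blast
    \<comment> \<open>All subsequence limits at \<open>t\<close> coincide: two of them,
      \<open>a\<close> and \<open>b\<close>, are both within
      \<open>\<omega> (t + 1) (X n - t)\<close> of \<open>vq (X n)\<close>, and this tends to 0.
      Compactness at \<open>t\<close> supplies one inside every subsequence, so the whole sequence
      converges.\<close>
    have "limitin \<sigma> (\<lambda>k. u (r k) t) a sequentially"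
    proof (rule limitin_by_subsequences)
      fix r2 :: "nat \<Rightarrow> nat" assume r2: "strict_mono r2"
      obtain r3 b where b: "strict_mono r3" "b \<in> S" "limitin \<sigma> (\<lambda>k. u ((r \<circ> r2) (r3 k)) t) b sequentially"
        using compact[OF t strict_mono_o[OF r r2]] by blast
      have r23: "strict_mono (r2 \<circ> r3)" by (rule strict_mono_o[OF r2 b(1)])
      have "\<forall>\<^sub>F n in sequentially. d a b \<le> 2 * \<omega> (t + 1) (X n - t)"
        using ev
      proof eventually_elim
        case (elim n)
        have Xn: "X n \<in> \<rat>" using X(1) by auto
        have "vq (X n) \<in> S"
          using limitin_topspace[OF vq[OF Xn]] X(2)[of n] t \<sigma> by simp
        then have "d a b \<le> d a (vq (X n)) + d b (vq (X n))" using triangle'[of a "vq (X n)" b] a b by simp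
        also have "\<dots> \<le> \<omega> (t + 1) (X n - t) + \<omega> (t + 1) (X n - t)"
          using near[OF t X(2) elim Xn a(1,3)] near[OF t X(2) elim Xn r23, of b] b(3)
          by (intro add_mono) (auto simp: o_def)
        finally show ?case by simp
      qed
      then have "d a b \<le> 0" using \<omega>0 by (intro tendsto_lowerbound) auto
      then have "a = b" using a b zero[of a b] nonneg[of a b] by simp
      then show "\<exists>r'. strict_mono r' \<and> limitin \<sigma> ((\<lambda>k. u (r k) t) \<circ> r2 \<circ> r') a sequentially"
        using b by (auto simp: o_def)
    qed (use a \<sigma> in simp)
    then show ?thesis by blast
  qed
  then obtain v where v: "\<And>t. 0 \<le> t \<Longrightarrow> limitin \<sigma> (\<lambda>k. u (r k) t) (v t) sequentially"
    by metis
  have vS: "v t \<in> S" if "0 \<le> t" for t using limitin_topspace[OF v[OF that]] \<sigma> by simp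
  have v\<omega>: "d (v s) (v t) \<le> \<omega> T (t - s)" if "0 \<le> s" "s \<le> t" "t \<le> T" for s t T
    using that by (intro lsc_le[OF _ _ v v, of s t "\<lambda>_. \<omega> T (t - s)"]) (auto intro: uS Holder)
  define f where "f = (\<lambda>x. lim (\<lambda>k. F (r k) x))"
  define g where "g = (\<lambda>x. lim (\<lambda>k. G (r k) x))"
  have f: "(\<lambda>k. F (r k) x) \<longlonglongrightarrow> f x" and g: "(\<lambda>k. G (r k) x) \<longlonglongrightarrow> g x" if "x \<in> \<rat>" for x
    using conv[OF that] by (auto simp: f_def g_def convergent_LIMSEQ_iff)
  have f_mono: "f x \<le> f y" and g_mono: "g x \<le> g y" if "x \<in> \<rat>" "y \<in> \<rat>" "x \<le> y" for x y
    using f[OF that(1)] f[OF that(2)] F(1)[OF that(3)] g[OF that(1)] g[OF that(2)] G(1)[OF that(3)]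
    by (auto intro: LIMSEQ_le)
  define F' where "F' = (\<lambda>t. INF x\<in>{x \<in> \<rat>. t < x}. f x)"
  define G' where "G' = (\<lambda>t. INF x\<in>{x \<in> \<rat>. t < x}. g x)"
  have F': "right_cont_mono F'"
    unfolding F'_def by (rule right_regularization(1)) (rule f_mono)
  have F'_lim: "(\<lambda>n. f (X n)) \<longlonglongrightarrow> F' t"
    if "range X \<subseteq> \<rat>" "\<And>n. t < X n" "X \<longlonglongrightarrow> t" for X t
    unfolding F'_def by (rule right_regularization(2)[OF _ that]) (rule f_mono)
  have G': "right_cont_mono G'"
    unfolding G'_def by (rule right_regularization(1)) (rule g_mono)
  have G'_lim: "(\<lambda>n. g (X n)) \<longlonglongrightarrow> G' t"
    if "range X \<subseteq> \<rat>" "\<And>n. t < X n" "X \<longlonglongrightarrow> t" for X t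
    unfolding G'_def by (rule right_regularization(2)[OF _ that]) (rule g_mono)
  \<comment> \<open>Two limits: \<open>k\<close> tends to infinity at rational times
    \<open>X n < Y n\<close>, and these approach \<open>s\<close> and \<open>t\<close> from the
    right.\<close>
  have Young': "p * c powr (p - 1) * (F' t - F' s) \<le> (p - 1) * c powr p * (t - s) + (G' t - G' s)"
    if c: "0 < c" and st: "s \<le> t" for c s t
  proof (cases "s = t")
    case False
    obtain X where X: "range X \<subseteq> \<rat>" "\<And>n. s < X n" "X \<longlonglongrightarrow> s" using rational_sequence_above[of s] by blast
    obtain Y where Y: "range Y \<subseteq> \<rat>" "\<And>n. t < Y n" "Y \<longlonglongrightarrow> t" using rational_sequence_above[of t] by blast
    have "\<forall>\<^sub>F n in sequentially. X n < t" using X(3) False st by (intro order_tendstoD) auto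
    then have ev: "\<forall>\<^sub>F n in sequentially. p * c powr (p - 1) * (f (Y n) - f (X n))
        \<le> (p - 1) * c powr p * (Y n - X n) + (g (Y n) - g (X n))"
    proof eventually_elim
      case (elim n)
      have XY: "X n \<in> \<rat>" "Y n \<in> \<rat>" using X(1) Y(1) by auto
      show ?case
      proof (rule LIMSEQ_le)
        show "(\<lambda>k. p * c powr (p - 1) * (F (r k) (Y n) - F (r k) (X n)))
            \<longlonglongrightarrow> p * c powr (p - 1) * (f (Y n) - f (X n))"
          by (intro tendsto_intros f XY)
        show "(\<lambda>k. (p - 1) * c powr p * (Y n - X n) + (G (r k) (Y n) - G (r k) (X n)))
            \<longlonglongrightarrow> (p - 1) * c powr p * (Y n - X n) + (g (Y n) - g (X n))"
          by (intro tendsto_intros g XY)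
        show "\<exists>N. \<forall>k\<ge>N. p * c powr (p - 1) * (F (r k) (Y n) - F (r k) (X n))
            \<le> (p - 1) * c powr p * (Y n - X n) + (G (r k) (Y n) - G (r k) (X n))"
          using elim Y(2)[of n] by (intro exI[of _ 0] allI impI Young c) simp
      qed
    qed
    show ?thesis
    proof (rule tendsto_le[OF _ _ _ ev])
      show "(\<lambda>n. (p - 1) * c powr p * (Y n - X n) + (g (Y n) - g (X n)))
          \<longlonglongrightarrow> (p - 1) * c powr p * (t - s) + (G' t - G' s)"
        by (intro tendsto_intros G'_lim[OF X] G'_lim[OF Y] X(3) Y(3))
      show "(\<lambda>n. p * c powr (p - 1) * (f (Y n) - f (X n))) \<longlonglongrightarrow> p * c powr (p - 1) * (F' t - F' s)"
        by (intro tendsto_intros F'_lim[OF X] F'_lim[OF Y])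
    qed simp
  qed simp
  \<comment> \<open>\<open>F (r k)\<close> is known to converge only at rational times, with limit
    \<open>f\<close>. The endpoints are moved to rationals at the cost of the modulus
    \<open>\<omega>\<close>.\<close>
  have vF: "d (v s) (v t) \<le> F' t - F' s" if st: "0 \<le> s" "s \<le> t" for s t
  proof -
    obtain X where X: "range X \<subseteq> \<rat>" "\<And>n. s < X n" "X \<longlonglongrightarrow> s" using rational_sequence_above[of s] by blast
    obtain Y where Y: "range Y \<subseteq> \<rat>" "\<And>n. t < Y n" "Y \<longlonglongrightarrow> t" using rational_sequence_above[of t] by blast
    have vf: "d (v x) (v y) \<le> f y - f x" if "x \<in> \<rat>" "y \<in> \<rat>" "0 \<le> x" "x \<le> y" for x y
    proof (rule lsc_le[OF _ _ v v])
      show "(\<lambda>k. F (r k) y - F (r k) x) \<longlonglongrightarrow> f y - f x" by (intro tendsto_intros f that)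
    qed (use that uS uF in auto)
    \<comment> \<open>For \<open>s = t\<close> the order of \<open>X n\<close> and
      \<open>Y n\<close> is not determined, hence the absolute value.\<close>
    have vf': "d (v x) (v y) \<le> \<bar>f y - f x\<bar>" if "x \<in> \<rat>" "y \<in> \<rat>" "0 \<le> x" "0 \<le> y" for x y
      using vf[of x y] vf[of y x] that commute[of "v x" "v y"] by (cases "x \<le> y") auto
    have "\<forall>\<^sub>F n in sequentially. X n < t + 1 \<and> Y n < t + 1"
      using X(3) Y(3) st by (intro eventually_conj order_tendstoD) auto
    then have "\<forall>\<^sub>F n in sequentially. d (v s) (v t)
        \<le> \<omega> (t + 1) (X n - s) + \<bar>f (Y n) - f (X n)\<bar> + \<omega> (t + 1) (Y n - t)"
    proof eventually_elim
      case (elim n)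
      have XY: "X n \<in> \<rat>" "Y n \<in> \<rat>" "0 \<le> X n" "0 \<le> Y n"
        using X(1) Y(1) X(2)[of n] Y(2)[of n] st by auto
      have "d (v s) (v t) \<le> d (v s) (v (X n)) + d (v (X n)) (v (Y n)) + d (v t) (v (Y n))"
        using triangle[of "v s" "v (X n)" "v t"] triangle'[of "v (X n)" "v (Y n)" "v t"] vS XY st by simp
      also have "\<dots> \<le> \<omega> (t + 1) (X n - s) + \<bar>f (Y n) - f (X n)\<bar> + \<omega> (t + 1) (Y n - t)"
        using elim X(2)[of n] Y(2)[of n] st XY by (intro add_mono v\<omega> vf') auto
      finally show ?case .
    qed
    moreover have "(\<lambda>n. \<omega> (t + 1) (X n - s) + \<bar>f (Y n) - f (X n)\<bar> + \<omega> (t + 1) (Y n - t))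
        \<longlonglongrightarrow> 0 + \<bar>F' t - F' s\<bar> + 0"
      using X Y by (intro tendsto_add tendsto_rabs tendsto_diff F'_lim[OF X] F'_lim[OF Y] \<omega>_lim) (auto simp: less_imp_le LIM_zero)
    ultimately have "d (v s) (v t) \<le> 0 + \<bar>F' t - F' s\<bar> + 0"
      by (intro tendsto_lowerbound) auto
    moreover have "F' s \<le> F' t" using F' st by (simp add: right_cont_mono_def mono_def)
    ultimately show ?thesis by simp
  qed
  obtain h where h: "h \<in> borel_measurable borel" "\<And>x. 0 \<le> h x"
    "\<And>s t. s \<le> t \<Longrightarrow> (h has_integral (F' t - F' s)) {s..t}"
    "\<And>s t. (\<lambda>x. h x powr p) integrable_on {s..t}"
    by (rule Radon_Nikodym_powr[OF p F' G' Young']) (assumption | rule that)+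
  have "AC_loc_curve p {0..} S d v"
    unfolding AC_loc_curve_def
  proof (intro conjI exI[of _ h] ballI impI)
    show "v ` {0..} \<subseteq> S" using vS by auto
    show "Lp_loc_on p {0..} h"
      unfolding Lp_loc_on_def Lp_on_def
    proof (intro allI impI conjI)
      fix K :: "real set" assume K: "compact K \<and> K \<subseteq> {0..}"
      have "K \<in> sets borel" using K by (intro borel_compact) simp
      then have KL: "K \<in> sets lebesgue" by (intro sets_completionI_sets) simp
      have hL: "h \<in> borel_measurable lebesgue" using h(1) by (intro measurable_completion) simp
      show "set_borel_measurable lebesgue K h"
        unfolding set_borel_measurable_def using KL hL
        by (intro borel_measurable_scaleR borel_measurable_indicator)
      obtain a b where ab: "K \<subseteq> {a..b}"
        using K compact_imp_bounded bounded_subset_cbox_symmetric by (metis box_real(2))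
      have "(\<lambda>x. \<bar>h x\<bar> powr p) absolutely_integrable_on {a..b}"
        using h(2,4) by (intro nonnegative_absolutely_integrable_1) auto
      then show "set_integrable lebesgue K (\<lambda>x. \<bar>h x\<bar> powr p)"
        by (rule set_integrable_subset[OF _ KL ab])
    qed
    fix s t :: real assume st: "s \<in> {0..}" "t \<in> {0..}" "s < t"
    have "h absolutely_integrable_on {s..t}"
      using h(2) h(3)[of s t] st by (intro nonnegative_absolutely_integrable_1) auto
    then have "set_lebesgue_integral lebesgue {s..t} h = F' t - F' s"
      using integral_unique[OF h(3)[of s t]] st by (simp add: set_lebesgue_integral_eq_integral(2))
    then show "d (v s) (v t) \<le> set_lebesgue_integral lebesgue {s..t} h"
      using vF[of s t] st by simp
  qed
  with that[OF r _ v] show thesis by blast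
qed

section \<open>Estimates uniform along the family of curves, and passage to the limit\<close>

lemma LIMSEQ_divide_nat_at_right:
  fixes b :: real
  assumes "0 < b"
  shows "filterlim (\<lambda>k. b / (real k + 2)) (at_right 0) sequentially"
proof -
  have "filterlim (\<lambda>k. 2 + real k) at_top sequentially"
    by (intro filterlim_tendsto_add_at_top[OF tendsto_const] filterlim_real_sequentially)
  then have "(\<lambda>k. b / (2 + real k)) \<longlonglongrightarrow> 0"
    by (rule tendsto_divide_0[OF tendsto_const filterlim_at_top_imp_at_infinity])
  then show ?thesis
    using assms by (auto simp: filterlim_at add.commute add_pos_nonneg intro!: always_eventually)
qed

theorem proposition2p2:
  fixes \<theta> \<beta> c\<^sub>0 :: real
    and S\<^sub>0 :: "'a set" and d\<^sub>0 :: "'a \<Rightarrow> 'a \<Rightarrow> real" and \<sigma> :: "'a topology"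
    and S :: "real \<Rightarrow> 'a set" and d :: "real \<Rightarrow> 'a \<Rightarrow> 'a \<Rightarrow> real"
    and \<phi> :: "'a \<Rightarrow> ereal" and g :: "real \<Rightarrow> 'a \<Rightarrow> ennreal"
    and u\<^sub>0 :: 'a and w :: "real \<Rightarrow> 'a" and u :: "real \<Rightarrow> real \<Rightarrow> 'a"
  assumes theta: "1 < \<theta>" and beta: "1 / \<theta> + 1 / \<beta> = 1"
    and metric0: "Metric_space S\<^sub>0 d\<^sub>0" and complete0: "Metric_space.mcomplete S\<^sub>0 d\<^sub>0"
    and sigma_space: "topspace \<sigma> = S\<^sub>0"
    and sigma_Hausdorff: "Hausdorff_space \<sigma>"
    and sigma_weaker: "\<And>U. openin \<sigma> U \<Longrightarrow> openin (Metric_space.mtopology S\<^sub>0 d\<^sub>0) U"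
    and d0_lsc: "\<And>x y a b. \<lbrakk>range x \<subseteq> S\<^sub>0; range y \<subseteq> S\<^sub>0;
                    limitin \<sigma> x a sequentially; limitin \<sigma> y b sequentially\<rbrakk>
                  \<Longrightarrow> ereal (d\<^sub>0 a b) \<le> liminf (\<lambda>k. ereal (d\<^sub>0 (x k) (y k)))"
    and metric_eps: "\<And>\<epsilon>. 0 < \<epsilon> \<Longrightarrow> Metric_space (S \<epsilon>) (d \<epsilon>)"
    and subset_eps: "\<And>\<epsilon>. 0 < \<epsilon> \<Longrightarrow> S \<epsilon> \<subseteq> S\<^sub>0"
    and c0_pos: "0 < c\<^sub>0"
    and d0_le: "\<And>\<epsilon> x y. \<lbrakk>0 < \<epsilon>; x \<in> S \<epsilon>; y \<in> S \<epsilon>\<rbrakk> \<Longrightarrow> d\<^sub>0 x y \<le> c\<^sub>0 * d \<epsilon> x y"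
    and phi_range: "\<And>x. x \<in> S\<^sub>0 \<Longrightarrow> \<phi> x > -\<infinity>"
    and phi_proper: "eff_dom S\<^sub>0 \<phi> \<noteq> {}"
    and Phi1: "\<And>x a. \<lbrakk>range x \<subseteq> S\<^sub>0; limitin \<sigma> x a sequentially;
                  bdd_above (range (\<lambda>(k, l). d\<^sub>0 (x k) (x l)))\<rbrakk>
                \<Longrightarrow> \<phi> a \<le> liminf (\<lambda>k. \<phi> (x k))"
    and Phi2: "\<exists>a\<in>S\<^sub>0. \<exists>B C :: real. 0 < C \<and> (\<forall>x\<in>S\<^sub>0. ereal (B - C * d\<^sub>0 x a powr \<theta>) \<le> \<phi> x)"
    and Phi3: "\<And>x :: nat \<Rightarrow> 'a. \<lbrakk>range x \<subseteq> S\<^sub>0; (SUP k. \<phi> (x k)) < \<infinity>;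
                  bdd_above (range (\<lambda>(k, l). d\<^sub>0 (x k) (x l)))\<rbrakk>
                \<Longrightarrow> \<exists>r a. strict_mono r \<and> a \<in> S\<^sub>0 \<and> limitin \<sigma> (x \<circ> r) a sequentially"
    and u0: "u\<^sub>0 \<in> eff_dom S\<^sub>0 \<phi>"
    and w_in: "\<And>\<epsilon>. 0 < \<epsilon> \<Longrightarrow> w \<epsilon> \<in> S \<epsilon>"
    and w_bounded: "bdd_above ((\<lambda>\<epsilon>. d\<^sub>0 (w \<epsilon>) u\<^sub>0) ` {0<..})"
    and w_lim: "limitin \<sigma> w u\<^sub>0 (at_right 0)"
    and phi_w_lim: "((\<lambda>\<epsilon>. \<phi> (w \<epsilon>)) \<longlongrightarrow> \<phi> u\<^sub>0) (at_right 0)"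
    and g_sug: "\<And>\<epsilon>. 0 < \<epsilon> \<Longrightarrow> strong_upper_gradient (S \<epsilon>) (d \<epsilon>) \<phi> (g \<epsilon>)"
    and u_cms: "\<And>\<epsilon>. 0 < \<epsilon> \<Longrightarrow> max_slope_curve \<theta> \<beta> (S \<epsilon>) (d \<epsilon>) \<phi> (g \<epsilon>) (w \<epsilon>) (u \<epsilon>)"
  shows "\<exists>(e :: nat \<Rightarrow> real) v.
           (\<forall>k. 0 < e k) \<and> e \<longlonglongrightarrow> 0 \<and>
           AC_loc_curve \<theta> {0..} S\<^sub>0 d\<^sub>0 v \<and> v 0 = u\<^sub>0 \<and>
           (\<forall>t\<ge>0. limitin \<sigma> (\<lambda>k. u (e k) t) (v t) sequentially) \<and>
           (\<forall>t\<ge>0. \<phi> (v t) \<le> \<phi> u\<^sub>0)"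
proof -
  interpret Metric_space S\<^sub>0 d\<^sub>0 by (rule metric0)
  obtain p0 where p0: "\<phi> u\<^sub>0 = ereal p0" and u0S: "u\<^sub>0 \<in> S\<^sub>0"
    using u0 phi_range[of u\<^sub>0] by (cases "\<phi> u\<^sub>0") (auto simp: eff_dom_def)
  have "\<forall>\<^sub>F \<epsilon> in at_right 0. \<phi> (w \<epsilon>) < ereal (p0 + 1)"
    by (rule order_tendstoD(2)[OF phi_w_lim]) (simp add: p0)
  then obtain b where b: "0 < b" "\<And>\<epsilon>. 0 < \<epsilon> \<Longrightarrow> \<epsilon> < b \<Longrightarrow> \<phi> (w \<epsilon>) < ereal (p0 + 1)"
    by (auto simp: eventually_at_right_field)
  \<comment> \<open>The initial energies are known to be below \<open>p0 + 1\<close> only for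
    parameters less than \<open>b\<close>; the summand 2 makes \<open>e k < b\<close> strict from
    \<open>k = 0\<close> on.\<close>
  define e where "e = (\<lambda>k. b / (real k + 2))"
  have e0: "0 < e k" for k using b by (simp add: e_def add_nonneg_pos)
  have eb: "e k < b" for k
  proof -
    have "b < b * (real k + 2)" using b(1) by (simp add: algebra_simps add_pos_nonneg)
    then show ?thesis by (simp add: e_def field_simps add_nonneg_pos)
  qed
  have e_lim: "filterlim e (at_right 0) sequentially"
    unfolding e_def by (rule LIMSEQ_divide_nat_at_right[OF b(1)])
  let ?u = "\<lambda>k. u (e k)"
  \<comment> \<open>All that the energy estimate yields for the \<open>k\<close>-th curve, in one
    predicate so that \<open>n\<close> and \<open>P\<close> are chosen together.\<close>
  define Q where "Q = (\<lambda>k n P. (\<forall>x. 0 \<le> n x) \<and> (\<forall>x<0. n x = 0) \<and>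
    (\<forall>a b. n integrable_on {a..b}) \<and> (\<forall>a b. (\<lambda>x. n x powr \<theta>) integrable_on {a..b}) \<and>
    (\<forall>s t. 0 \<le> s \<longrightarrow> s \<le> t \<longrightarrow> d (e k) (?u k s) (?u k t) \<le> integral {s..t} n) \<and>
    (\<forall>t\<ge>0. \<phi> (?u k t) = ereal (P t)) \<and>
    (\<forall>s t. 0 \<le> s \<longrightarrow> s \<le> t \<longrightarrow> integral {s..t} (\<lambda>x. n x powr \<theta>) \<le> \<theta> * (P s - P t)))"
  have "\<exists>n P. Q k n P" for k
  proof (rule max_slope_curve_energy[OF metric_eps[OF e0] theta beta u_cms[OF e0]])
    show "-\<infinity> < \<phi> x" if "x \<in> S (e k)" for x
      using phi_range subset_eps[OF e0] that by blast
    show ?thesis if "\<And>x. 0 \<le> n x" "\<And>x. x < 0 \<Longrightarrow> n x = 0" "\<And>a b. n integrable_on {a..b}"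
      "\<And>a b. (\<lambda>x. n x powr \<theta>) integrable_on {a..b}"
      "\<And>s t. 0 \<le> s \<Longrightarrow> s \<le> t \<Longrightarrow> d (e k) (?u k s) (?u k t) \<le> integral {s..t} n"
      "\<And>t. 0 \<le> t \<Longrightarrow> \<phi> (?u k t) = ereal (P t)"
      "\<And>s t. 0 \<le> s \<Longrightarrow> s \<le> t \<Longrightarrow> integral {s..t} (\<lambda>x. n x powr \<theta>) \<le> \<theta> * (P s - P t)" for n P
      unfolding Q_def by (intro exI[of _ n] exI[of _ P] conjI allI impI that)
  qed
  then obtain n P where Q: "\<And>k. Q k (n k) (P k)" by metis
  have n: "0 \<le> n k x" "x < 0 \<Longrightarrow> n k x = 0" "n k integrable_on {y..z}"
    "(\<lambda>x. n k x powr \<theta>) integrable_on {y..z}" for k x y z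
    using Q[of k] unfolding Q_def by blast+
  have un: "d (e k) (?u k s) (?u k t) \<le> integral {s..t} (n k)"
    and nP: "integral {s..t} (\<lambda>x. n k x powr \<theta>) \<le> \<theta> * (P k s - P k t)" if "0 \<le> s" "s \<le> t" for k s t
    using Q[of k] that unfolding Q_def by blast+
  have P: "\<phi> (?u k t) = ereal (P k t)" if "0 \<le> t" for k t
    using Q[of k] that unfolding Q_def by blast
  have u_init: "?u k 0 = w (e k)" for k
    using u_cms[OF e0, of k] by (simp add: max_slope_curve_def)
  have uS: "?u k t \<in> S (e k)" if "0 \<le> t" for k t
    using u_cms[OF e0, of k] that by (auto simp: max_slope_curve_def AC_loc_curve_def)
  have uS0: "?u k t \<in> S\<^sub>0" if "0 \<le> t" for k t using uS[OF that] subset_eps[OF e0] by blast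
  have P_mono: "P k t \<le> P k s" if "0 \<le> s" "s \<le> t" for k s t
  proof -
    have "0 \<le> integral {s..t} (\<lambda>x. n k x powr \<theta>)" by (intro integral_nonneg n) simp
    also have "\<dots> \<le> \<theta> * (P k s - P k t)" by (rule nP[OF that])
    finally show ?thesis using theta by (simp add: zero_le_mult_iff)
  qed
  have P_le: "P k t \<le> p0 + 1" if "0 \<le> t" for k t
  proof -
    have "ereal (P k 0) < ereal (p0 + 1)" using P[of 0 k] u_init[of k] b(2)[OF e0 eb, of k] by simp
    then show ?thesis using P_mono[of 0 t k] that by simp
  qed
  \<comment> \<open>By the comparison of the metrics, this bounds the speed measured in
    \<open>d\<^sub>0\<close>.\<close>
  define m where "m = (\<lambda>k x. c\<^sub>0 * n k x)"
  have m0: "0 \<le> m k x" for k x using n(1)[of k x] c0_pos by (simp add: m_def)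
  have mp: "(\<lambda>x. m k x powr \<theta>) = (\<lambda>x. c\<^sub>0 powr \<theta> * n k x powr \<theta>)" for k
    using c0_pos n(1) by (simp add: m_def powr_mult)
  define F where "F = (\<lambda>k t. integral {0..t} (m k))"
  define G where "G = (\<lambda>k t. integral {0..t} (\<lambda>x. m k x powr \<theta>))"
  have F: "(m k has_integral (F k t - F k s)) {s..t}" if "s \<le> t" for k s t
    unfolding F_def
  proof (rule has_integral_indefinite[OF _ _ that])
    show "m k integrable_on {y..z}" for y z
      using integrable_cmul[OF n(3)[of k y z], of c\<^sub>0] by (simp add: m_def)
  qed (simp add: m_def n)
  have G: "((\<lambda>x. m k x powr \<theta>) has_integral (G k t - G k s)) {s..t}" if "s \<le> t" for k s t
    unfolding G_def
  proof (rule has_integral_indefinite[OF _ _ that])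
    show "(\<lambda>x. m k x powr \<theta>) integrable_on {y..z}" for y z
      using integrable_cmul[OF n(4)[of k y z], of "c\<^sub>0 powr \<theta>"] by (simp add: mp)
  qed (simp add: m_def n)
  have F_mono: "F k s \<le> F k t" and G_mono: "G k s \<le> G k t" if "s \<le> t" for k s t
    using has_integral_nonneg[OF F[OF that]] has_integral_nonneg[OF G[OF that]] m0 by simp_all
  have FG0: "F k t = 0" "G k t = 0" if "t \<le> 0" for k t
    using that by (cases "t = 0"; simp add: F_def G_def)+
  have Young: "\<theta> * c powr (\<theta> - 1) * (F k t - F k s) \<le> (\<theta> - 1) * c powr \<theta> * (t - s) + (G k t - G k s)"
    if "0 < c" "s \<le> t" for k c s t
    using that by (intro Young_has_integral[OF theta _ _ m0 F G])
  have uF: "d\<^sub>0 (?u k s) (?u k t) \<le> F k t - F k s" if st: "0 \<le> s" "s \<le> t" for k s t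
  proof -
    have "d\<^sub>0 (?u k s) (?u k t) \<le> c\<^sub>0 * d (e k) (?u k s) (?u k t)"
      using st by (intro d0_le e0 uS) auto
    also have "\<dots> \<le> c\<^sub>0 * integral {s..t} (n k)" using un[OF st] c0_pos by (intro mult_left_mono) auto
    also have "\<dots> = integral {s..t} (m k)" by (simp add: m_def)
    also have "\<dots> = F k t - F k s" by (rule integral_unique[OF F[OF st(2)]])
    finally show ?thesis .
  qed
  from Phi2 obtain a B C where a: "a \<in> S\<^sub>0" and C: "0 < C"
    and phi_ge: "\<And>x. x \<in> S\<^sub>0 \<Longrightarrow> ereal (B - C * d\<^sub>0 x a powr \<theta>) \<le> \<phi> x" by blast
  \<comment> \<open>The energy loss on \<open>[s,t]\<close> is at most \<open>p0 + 1\<close> minus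
    the lower bound of (\<Phi>2) at time \<open>t\<close>; the factor
    \<open>c\<^sub>0 powr \<theta> * \<theta>\<close> turns it into a bound for the increment of
    \<open>G\<close>. The maximum with 0 gives the sign that \<open>superlinear_growth_bound\<close>
    asks for.\<close>
  define K1 where "K1 = c\<^sub>0 powr \<theta> * \<theta> * max 0 (p0 + 1 - B)"
  define K2 where "K2 = c\<^sub>0 powr \<theta> * \<theta> * C"
  have K: "0 \<le> K1" "0 \<le> K2" using theta C by (auto simp: K1_def K2_def)
  have GK: "G k t - G k s \<le> K1 + K2 * d\<^sub>0 (?u k t) a powr \<theta>" if st: "0 \<le> s" "s \<le> t" for k s t
  proof -
    have "ereal (B - C * d\<^sub>0 (?u k t) a powr \<theta>) \<le> ereal (P k t)"
      using phi_ge[OF uS0, of t k] P[of t k] st by simp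
    then have "P k s - P k t \<le> max 0 (p0 + 1 - B) + C * d\<^sub>0 (?u k t) a powr \<theta>"
      using P_le[OF st(1), of k] by simp
    then have "c\<^sub>0 powr \<theta> * \<theta> * (P k s - P k t)
        \<le> c\<^sub>0 powr \<theta> * \<theta> * (max 0 (p0 + 1 - B) + C * d\<^sub>0 (?u k t) a powr \<theta>)"
      using theta by (intro mult_left_mono) auto
    moreover have "G k t - G k s = c\<^sub>0 powr \<theta> * integral {s..t} (\<lambda>x. n k x powr \<theta>)"
      using integral_unique[OF G[OF st(2), of k]] by (simp add: mp)
    moreover have "\<dots> \<le> c\<^sub>0 powr \<theta> * (\<theta> * (P k s - P k t))"
      using nP[OF st] by (intro mult_left_mono) auto
    ultimately show ?thesis by (simp add: K1_def K2_def distrib_left mult.assoc)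
  qed
  obtain R where R: "d\<^sub>0 (w \<epsilon>) u\<^sub>0 \<le> R" if "0 < \<epsilon>" for \<epsilon>
    using w_bounded by (auto simp: bdd_above_def)
  have "\<exists>D. \<forall>k t. 0 \<le> t \<longrightarrow> t \<le> T \<longrightarrow> d\<^sub>0 (?u k t) a \<le> D" for T
  proof -
    obtain D where D: "\<And>D' \<Delta> t. \<lbrakk>D' 0 \<le> R + d\<^sub>0 u\<^sub>0 a; \<And>t. 0 \<le> t \<Longrightarrow> 0 \<le> D' t;
      \<And>s t. \<lbrakk>0 \<le> s; s \<le> t\<rbrakk> \<Longrightarrow> D' t \<le> D' s + \<Delta> s t \<and> 0 \<le> \<Delta> s t \<and>
        \<Delta> s t powr \<theta> \<le> (t - s) powr (\<theta> - 1) * (K1 + K2 * D' t powr \<theta>);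
      0 \<le> t; t \<le> T\<rbrakk> \<Longrightarrow> D' t \<le> (D :: real)"
      using superlinear_growth_bound[OF theta K, of "R + d\<^sub>0 u\<^sub>0 a" T] by blast
    have "d\<^sub>0 (?u k t) a \<le> D" if t: "0 \<le> t" "t \<le> T" for k t
    proof (rule D[of "\<lambda>t. d\<^sub>0 (?u k t) a" "\<lambda>s t. d\<^sub>0 (?u k s) (?u k t)", OF _ _ _ t])
      show "d\<^sub>0 (?u k 0) a \<le> R + d\<^sub>0 u\<^sub>0 a"
        using triangle[of "?u k 0" u\<^sub>0 a] uS0[of 0 k] u0S a R[OF e0, of k] u_init[of k] by simp
    next
      fix s t :: real assume st: "0 \<le> s" "s \<le> t"
      have "d\<^sub>0 (?u k t) a \<le> d\<^sub>0 (?u k s) a + d\<^sub>0 (?u k s) (?u k t)"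
        using triangle''[of "?u k t" "?u k s" a] uS0[of s k] uS0[of t k] a st by simp
      \<comment> \<open>Hoelder's inequality for the step from \<open>s\<close> to \<open>t\<close>.
        \<open>GK\<close> then brings in the distance at the later time \<open>t\<close>, in the
        form that the growth bound can absorb.\<close>
      moreover have "d\<^sub>0 (?u k s) (?u k t) powr \<theta> \<le> (t - s) powr (\<theta> - 1) * (G k t - G k s)"
      proof (rule Young_imp_Holder[OF theta])
        fix c :: real assume c: "0 < c"
        have "\<theta> * c powr (\<theta> - 1) * d\<^sub>0 (?u k s) (?u k t) \<le> \<theta> * c powr (\<theta> - 1) * (F k t - F k s)"
          using theta uF[OF st] by (intro mult_left_mono) auto
        also note Young[OF c st(2)]
        finally show "\<theta> * c powr (\<theta> - 1) * d\<^sub>0 (?u k s) (?u k t)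
            \<le> (\<theta> - 1) * c powr \<theta> * (t - s) + (G k t - G k s)" .
      qed (use st G_mono in auto)
      moreover have "\<dots> \<le> (t - s) powr (\<theta> - 1) * (K1 + K2 * d\<^sub>0 (?u k t) a powr \<theta>)"
        by (intro mult_left_mono GK st) simp
      ultimately show "d\<^sub>0 (?u k t) a \<le> d\<^sub>0 (?u k s) a + d\<^sub>0 (?u k s) (?u k t) \<and>
          0 \<le> d\<^sub>0 (?u k s) (?u k t) \<and> d\<^sub>0 (?u k s) (?u k t) powr \<theta>
          \<le> (t - s) powr (\<theta> - 1) * (K1 + K2 * d\<^sub>0 (?u k t) a powr \<theta>)"
        by simp
    qed simp
    then show ?thesis by blast
  qed
  then obtain D where D: "\<And>T k t. 0 \<le> t \<Longrightarrow> t \<le> T \<Longrightarrow> d\<^sub>0 (?u k t) a \<le> D T" by metis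
  have pair_bound: "d\<^sub>0 (?u k t) (?u l t) \<le> 2 * D t" if "0 \<le> t" for k l t
    using triangle'[of "?u k t" a "?u l t"] uS0[OF that] a D[OF that order_refl, of k] D[OF that order_refl, of l]
    by (simp add: commute)
  have G_bound: "\<exists>A. \<forall>k. G k T \<le> A" for T
  proof (cases "0 \<le> T")
    case True
    have "G k T \<le> K1 + K2 * D T powr \<theta>" for k
    proof -
      have "G k T \<le> K1 + K2 * d\<^sub>0 (?u k T) a powr \<theta>" using GK[of 0 T k] FG0[of 0 k] True by simp
      also have "\<dots> \<le> K1 + K2 * D T powr \<theta>"
        using D[OF True order_refl, of k] K theta by (intro add_left_mono mult_left_mono powr_mono2) auto
      finally show ?thesis .
    qed
    then show ?thesis by blast
  qed (use FG0 in \<open>auto intro!: exI[of _ 0]\<close>)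
  \<comment> \<open>At a fixed time \<open>t\<close> all curves have energy at most
    \<open>p0 + 1\<close> and mutual distances at most \<open>2 * D t\<close>, which are the two
    bounds that (\<Phi>3) asks for.\<close>
  have compact: "\<exists>(r :: nat \<Rightarrow> nat) x. strict_mono r \<and> x \<in> S\<^sub>0 \<and> limitin \<sigma> (\<lambda>k. ?u (s (r k)) t) x sequentially"
    if t: "0 \<le> t" for t and s :: "nat \<Rightarrow> nat"
  proof -
    have "(SUP k. \<phi> (?u (s k) t)) \<le> ereal (p0 + 1)"
      using P_le[OF t] by (intro SUP_least) (simp add: P[OF t])
    then have "(SUP k. \<phi> (?u (s k) t)) < \<infinity>" by (rule le_less_trans) simp
    moreover have "bdd_above (range (\<lambda>(k, l). d\<^sub>0 (?u (s k) t) (?u (s l) t)))"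
      using pair_bound[OF t] by (intro bdd_aboveI[of _ "2 * D t"]) auto
    ultimately show ?thesis
      using Phi3[of "\<lambda>k. ?u (s k) t"] uS0[OF t] by (auto simp: o_def)
  qed
  obtain r v where r: "strict_mono r" and v: "AC_loc_curve \<theta> {0..} S\<^sub>0 d\<^sub>0 v"
    "\<And>t. 0 \<le> t \<Longrightarrow> limitin \<sigma> (\<lambda>k. ?u (r k) t) (v t) sequentially"
    using AC_limit_curve[OF metric0 sigma_space theta d0_lsc uS0 F_mono FG0(1) G_mono FG0(2) uF Young G_bound compact]
    by blast
  have er_lim: "filterlim (\<lambda>k. e (r k)) (at_right 0) sequentially"
    using filterlim_compose[OF e_lim filterlim_subseq[OF r]] .
  have w_seq: "limitin \<sigma> (\<lambda>k. w (e (r k))) u\<^sub>0 sequentially"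
    using w_lim er_lim unfolding limitin_def filterlim_iff by blast
  \<comment> \<open>Both points are \<sigma>-limits of the initial points
    \<open>w (e (r k))\<close>, so the Hausdorff property makes them equal.\<close>
  have "v 0 = u\<^sub>0"
    using limitin_Hausdorff_unique[OF v(2)[of 0] _ _ sigma_Hausdorff] w_seq by (simp add: u_init)
  moreover have "\<phi> (v t) \<le> \<phi> u\<^sub>0" if t: "0 \<le> t" for t
  proof -
    have "\<phi> (v t) \<le> liminf (\<lambda>k. \<phi> (?u (r k) t))"
      using uS0[OF t] pair_bound[OF t] by (intro Phi1 v(2) t bdd_aboveI[of _ "2 * D t"]) auto
    \<comment> \<open>The energy does not increase along any of the curves, and the initial energies
      converge to that of \<open>u\<^sub>0\<close>.\<close>
    also have "\<dots> \<le> liminf (\<lambda>k. \<phi> (w (e (r k))))"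
    proof (intro Liminf_mono always_eventually allI)
      fix k show "\<phi> (?u (r k) t) \<le> \<phi> (w (e (r k)))"
        using P[OF t, of "r k"] P[of 0 "r k"] u_init[of "r k"] P_mono[of 0 t "r k"] t by simp
    qed
    also have "\<dots> = \<phi> u\<^sub>0"
      using filterlim_compose[OF phi_w_lim er_lim] by (intro lim_imp_Liminf) auto
    finally show ?thesis .
  qed
  moreover have "(\<lambda>k. e (r k)) \<longlonglongrightarrow> 0" using er_lim by (simp add: filterlim_at)
  ultimately show ?thesis
    using e0 v by (intro exI[of _ "\<lambda>k. e (r k)"] exI[of _ v]) auto
qed

end
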